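(* There exist a free $W(k\llbracket t\rrbracket)$-module $M$ of rank $2$, an isogeny $F:\sigma^*M\to M$, and an element $\mathbf{v}$ of $(M\otimes_{W(k\llbracket t\rrbracket)} W(k((t))))\setminus M$ such that $F\mathbf{v}=\mathbf{v}$.
   Context: Let $k$ be an algebraically closed field of characteristic $p>0$. For a ring $A$ of characteristic $p$, $W(A)$ denotes the ring of $p$-typical Witt vectors over $A$, and $\sigma$ denotes the Witt vector Frobenius on $W(A)$ (induced by the $p$-power map on $A$). Here $\sigma^*M = M\otimes_{W(k\llbracket t\rrbracket),\sigma}W(k\llbracket t\rrbracket)$, and an isogeny is a morphism of modules whose kernel and cokernel are killed by some power of $p$. The isogeny $F$ induces a $\sigma$-linear map $M\to M$, and by $\sigma$-linear extension a map on $M\otimes W(k((t)))$, both again denoted $F$. As $M$ is free, it is regarded as a submodule of $M\otimes W(k((t)))$. *)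

theory Defs
  imports
    "HOL-Computational_Algebra.Formal_Laurent_Series"
    "HOL-Algebra.Free_Abelian_Groups"
    "HOL-Algebra.Generated_Groups"
    "HOL-Algebra.AbelCoset"
    "HOL-Algebra.Module"
begin

section \<open>Witt vectors\<close>

definition ghost :: "nat \<Rightarrow> (nat \<Rightarrow> 'a::comm_ring_1) \<Rightarrow> nat \<Rightarrow> 'a" where
  "ghost p x n = (\<Sum>i\<le>n. of_nat p ^ i * x i ^ (p ^ (n - i)))"

text \<open>Integer polynomials in two countable families of variables: \<open>X\<^sub>i\<close> is indexed by
  \<open>Inl i\<close> and \<open>Y\<^sub>i\<close> by \<open>Inr i\<close>.\<close>

type_synonym xy_poly = "((nat + nat) \<Rightarrow>\<^sub>0 nat) \<Rightarrow>\<^sub>0 int"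

definition xy_var :: "nat + nat \<Rightarrow> xy_poly" where
  "xy_var v = Poly_Mapping.single (Poly_Mapping.single v 1) 1"

definition xy_eval :: "(nat + nat \<Rightarrow> 'a::comm_ring_1) \<Rightarrow> xy_poly \<Rightarrow> 'a" where
  "xy_eval f P = (\<Sum>m\<in>Poly_Mapping.keys P. of_int (Poly_Mapping.lookup P m) *
     (\<Prod>v\<in>Poly_Mapping.keys m. f v ^ Poly_Mapping.lookup m v))"

text \<open>For prime \<open>p\<close>, Witt's theorem says that the following two families of integer polynomials
  exist; they are unique because the polynomial ring is torsion free.\<close>

definition witt_sum_poly :: "nat \<Rightarrow> nat \<Rightarrow> xy_poly" where
  "witt_sum_poly p = (THE S. \<forall>n. ghost p S n =
     ghost p (\<lambda>i. xy_var (Inl i)) n + ghost p (\<lambda>i. xy_var (Inr i)) n)"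

definition witt_prod_poly :: "nat \<Rightarrow> nat \<Rightarrow> xy_poly" where
  "witt_prod_poly p = (THE P. \<forall>n. ghost p P n =
     ghost p (\<lambda>i. xy_var (Inl i)) n * ghost p (\<lambda>i. xy_var (Inr i)) n)"

type_synonym 'a witt = "nat \<Rightarrow> 'a"

definition witt_ring :: "nat \<Rightarrow> 'a::comm_ring_1 witt ring" where
  "witt_ring p =
     \<lparr>carrier = UNIV,
      monoid.mult = (\<lambda>x y n. xy_eval (case_sum x y) (witt_prod_poly p n)),
      one = (\<lambda>n. if n = 0 then 1 else 0),
      ring.zero = (\<lambda>n. 0),
      add = (\<lambda>x y n. xy_eval (case_sum x y) (witt_sum_poly p n))\<rparr>"

definition witt_map :: "('a \<Rightarrow> 'b) \<Rightarrow> 'a witt \<Rightarrow> 'b witt" where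
  "witt_map f x = (\<lambda>n. f (x n))"

text \<open>The Witt vector Frobenius of a ring of characteristic \<open>p\<close>.\<close>

definition witt_frob :: "nat \<Rightarrow> 'a::comm_ring_1 witt \<Rightarrow> 'a witt" where
  "witt_frob p = witt_map (\<lambda>a. a ^ p)"


section \<open>Modules\<close>

definition free_of_rank :: "('r, 'x) ring_scheme \<Rightarrow> ('r, 'm, 'y) module_scheme \<Rightarrow> nat \<Rightarrow> bool" where
  "free_of_rank R M n \<longleftrightarrow> (\<exists>b \<in> {..<n} \<rightarrow> carrier M. \<forall>m \<in> carrier M.
     \<exists>!c. c \<in> {..<n} \<rightarrow>\<^sub>E carrier R \<and> m = (\<Oplus>\<^bsub>M\<^esub>i\<in>{..<n}. c i \<odot>\<^bsub>M\<^esub> b i))"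

definition module_hom_set ::
  "('r, 'x) ring_scheme \<Rightarrow> ('r, 'm, 'y) module_scheme \<Rightarrow> ('r, 'n, 'z) module_scheme \<Rightarrow> ('m \<Rightarrow> 'n) set" where
  "module_hom_set R M N = {h \<in> carrier M \<rightarrow> carrier N.
     (\<forall>x\<in>carrier M. \<forall>y\<in>carrier M. h (x \<oplus>\<^bsub>M\<^esub> y) = h x \<oplus>\<^bsub>N\<^esub> h y) \<and>
     (\<forall>r\<in>carrier R. \<forall>x\<in>carrier M. h (r \<odot>\<^bsub>M\<^esub> x) = r \<odot>\<^bsub>N\<^esub> h x)}"

definition killed_by_power :: "nat \<Rightarrow> ('g, 'x) monoid_scheme \<Rightarrow> bool" where
  "killed_by_power p G \<longleftrightarrow> (\<exists>n::nat. \<forall>x\<in>carrier G. x [^]\<^bsub>G\<^esub> (p ^ n) = \<one>\<^bsub>G\<^esub>)"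

definition isogeny ::
  "nat \<Rightarrow> ('r, 'x) ring_scheme \<Rightarrow> ('r, 'm, 'y) module_scheme \<Rightarrow> ('r, 'n, 'z) module_scheme \<Rightarrow>
   ('m \<Rightarrow> 'n) \<Rightarrow> bool" where
  "isogeny p R M N h \<longleftrightarrow> h \<in> module_hom_set R M N \<and>
     killed_by_power p (add_monoid (M\<lparr>carrier := a_kernel M N h\<rparr>)) \<and>
     killed_by_power p (N A_Mod (h ` carrier M))"


section \<open>Base change along a ring homomorphism\<close>

text \<open>\<open>M \<otimes>\<^bsub>R,\<phi>\<^esub> S\<close> is the free abelian group on \<open>M \<times> S\<close> modulo the subgroup generated by
  the usual relations, \<open>S\<close> being an \<open>R\<close>-algebra through \<open>\<phi> : R \<rightarrow> S\<close>.\<close>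

definition tensor_rels ::
  "('r, 'x) ring_scheme \<Rightarrow> ('s, 'w) ring_scheme \<Rightarrow> ('r \<Rightarrow> 's) \<Rightarrow> ('r, 'm, 'y) module_scheme \<Rightarrow>
   (('m \<times> 's) \<Rightarrow>\<^sub>0 int) set" where
  "tensor_rels R S \<phi> M =
     {frag_of (m \<oplus>\<^bsub>M\<^esub> m', s) - frag_of (m, s) - frag_of (m', s) | m m' s.
        m \<in> carrier M \<and> m' \<in> carrier M \<and> s \<in> carrier S} \<union>
     {frag_of (m, s \<oplus>\<^bsub>S\<^esub> s') - frag_of (m, s) - frag_of (m, s') | m s s'.
        m \<in> carrier M \<and> s \<in> carrier S \<and> s' \<in> carrier S} \<union>
     {frag_of (r \<odot>\<^bsub>M\<^esub> m, s) - frag_of (m, \<phi> r \<otimes>\<^bsub>S\<^esub> s) | r m s.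
        r \<in> carrier R \<and> m \<in> carrier M \<and> s \<in> carrier S}"

definition tensor_null ::
  "('r, 'x) ring_scheme \<Rightarrow> ('s, 'w) ring_scheme \<Rightarrow> ('r \<Rightarrow> 's) \<Rightarrow> ('r, 'm, 'y) module_scheme \<Rightarrow>
   (('m \<times> 's) \<Rightarrow>\<^sub>0 int) set" where
  "tensor_null R S \<phi> M =
     generate (free_Abelian_group (carrier M \<times> carrier S)) (tensor_rels R S \<phi> M)"

definition tensor_class ::
  "('r, 'x) ring_scheme \<Rightarrow> ('s, 'w) ring_scheme \<Rightarrow> ('r \<Rightarrow> 's) \<Rightarrow> ('r, 'm, 'y) module_scheme \<Rightarrow>
   (('m \<times> 's) \<Rightarrow>\<^sub>0 int) \<Rightarrow> (('m \<times> 's) \<Rightarrow>\<^sub>0 int) set" where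
  "tensor_class R S \<phi> M a =
     tensor_null R S \<phi> M #>\<^bsub>free_Abelian_group (carrier M \<times> carrier S)\<^esub> a"

text \<open>The pure tensor \<open>m \<otimes> s\<close>.\<close>

definition tensor ::
  "('r, 'x) ring_scheme \<Rightarrow> ('s, 'w) ring_scheme \<Rightarrow> ('r \<Rightarrow> 's) \<Rightarrow> ('r, 'm, 'y) module_scheme \<Rightarrow>
   'm \<Rightarrow> 's \<Rightarrow> (('m \<times> 's) \<Rightarrow>\<^sub>0 int) set" where
  "tensor R S \<phi> M m s = tensor_class R S \<phi> M (frag_of (m, s))"

text \<open>The additive self-map of \<open>M \<otimes>\<^bsub>R,\<phi>\<^esub> S\<close> with \<open>m \<otimes> s \<mapsto> f m \<otimes> g s\<close>. When this is well defined
  the union is over equal cosets, as in the library's multiplication on a quotient ring.\<close>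

definition tensor_map ::
  "('r, 'x) ring_scheme \<Rightarrow> ('s, 'w) ring_scheme \<Rightarrow> ('r \<Rightarrow> 's) \<Rightarrow> ('r, 'm, 'y) module_scheme \<Rightarrow>
   ('m \<Rightarrow> 'm) \<Rightarrow> ('s \<Rightarrow> 's) \<Rightarrow> (('m \<times> 's) \<Rightarrow>\<^sub>0 int) set \<Rightarrow> (('m \<times> 's) \<Rightarrow>\<^sub>0 int) set" where
  "tensor_map R S \<phi> M f g X =
     (\<Union>a\<in>X. tensor_class R S \<phi> M (frag_extend (\<lambda>(m, s). frag_of (f m, g s)) a))"

text \<open>The fields \<open>mult\<close> and \<open>one\<close> of a module record carry no meaning.\<close>

definition base_change ::
  "('r, 'x) ring_scheme \<Rightarrow> ('s, 'w) ring_scheme \<Rightarrow> ('r \<Rightarrow> 's) \<Rightarrow> ('r, 'm, 'y) module_scheme \<Rightarrow>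
   ('s, (('m \<times> 's) \<Rightarrow>\<^sub>0 int) set) module" where
  "base_change R S \<phi> M =
     (let T = free_Abelian_group (carrier M \<times> carrier S) Mod tensor_null R S \<phi> M in
      \<lparr>carrier = carrier T,
       monoid.mult = undefined,
       one = undefined,
       ring.zero = \<one>\<^bsub>T\<^esub>,
       add = (\<lambda>X Y. X \<otimes>\<^bsub>T\<^esub> Y),
       module.smult = (\<lambda>s. tensor_map R S \<phi> M (\<lambda>m. m) (\<lambda>s'. s \<otimes>\<^bsub>S\<^esub> s'))\<rparr>)"


section \<open>Frobenius modules over \<open>W(k[[t]])\<close>\<close>

abbreviation W_fps :: "nat \<Rightarrow> 'k::field fps witt ring" where
  "W_fps p \<equiv> witt_ring p"

abbreviation W_fls :: "nat \<Rightarrow> 'k::field fls witt ring" where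
  "W_fls p \<equiv> witt_ring p"

definition sigma_pullback ::
  "nat \<Rightarrow> ('k::field fps witt, 'm) module \<Rightarrow>
   ('k fps witt, (('m \<times> 'k fps witt) \<Rightarrow>\<^sub>0 int) set) module" where
  "sigma_pullback p M = base_change (W_fps p) (W_fps p) (witt_frob p) M"

definition generic_module ::
  "nat \<Rightarrow> ('k::field fps witt, 'm) module \<Rightarrow>
   ('k fls witt, (('m \<times> 'k fls witt) \<Rightarrow>\<^sub>0 int) set) module" where
  "generic_module p M = base_change (W_fps p) (W_fls p) (witt_map fps_to_fls) M"

text \<open>The map \<open>m \<mapsto> m \<otimes> 1\<close>, through which a free module \<open>M\<close> is regarded as a submodule.\<close>

definition to_generic ::
  "nat \<Rightarrow> ('k::field fps witt, 'm) module \<Rightarrow> 'm \<Rightarrow> (('m \<times> 'k fls witt) \<Rightarrow>\<^sub>0 int) set" where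
  "to_generic p M m = tensor (W_fps p) (W_fls p) (witt_map fps_to_fls) M m \<one>\<^bsub>W_fls p\<^esub>"

text \<open>The \<open>\<sigma>\<close>-linear map \<open>m \<mapsto> F (m \<otimes> 1)\<close> on \<open>M\<close> and its \<open>\<sigma>\<close>-linear extension
  \<open>m \<otimes> s \<mapsto> F (m \<otimes> 1) \<otimes> \<sigma> s\<close>.\<close>

definition frob_semilinear ::
  "nat \<Rightarrow> ('k::field fps witt, 'm) module \<Rightarrow> ((('m \<times> 'k fps witt) \<Rightarrow>\<^sub>0 int) set \<Rightarrow> 'm) \<Rightarrow>
   'm \<Rightarrow> 'm" where
  "frob_semilinear p M F m = F (tensor (W_fps p) (W_fps p) (witt_frob p) M m \<one>\<^bsub>W_fps p\<^esub>)"

definition frob_generic ::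
  "nat \<Rightarrow> ('k::field fps witt, 'm) module \<Rightarrow> ((('m \<times> 'k fps witt) \<Rightarrow>\<^sub>0 int) set \<Rightarrow> 'm) \<Rightarrow>
   (('m \<times> 'k fls witt) \<Rightarrow>\<^sub>0 int) set \<Rightarrow> (('m \<times> 'k fls witt) \<Rightarrow>\<^sub>0 int) set" where
  "frob_generic p M F =
     tensor_map (W_fps p) (W_fls p) (witt_map fps_to_fls) M (frob_semilinear p M F) (witt_frob p)"

end

theory Submission
  imports Defs
begin

text \<open>
  Write \<open>K = k((t))\<close>, \<open>\<sigma>\<close> for the Frobenius, \<open>V\<close> for the Verschiebung and \<open>S = [t\<^sup>-\<^sup>1]\<close>. Take
  \<open>M = W(k[[t]])\<^sup>2\<close> with \<open>F(u, v) = (a \<sigma>u + \<sigma>v, p\<^sup>5 \<sigma>u)\<close>; its determinant is \<open>- p\<^sup>5\<close>, so it is an isogeny,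
  and \<open>\<^bold>v = (x, p\<^sup>5 \<sigma>x)\<close> is fixed iff \<open>x = a \<sigma>x + p\<^sup>5 \<sigma>\<^sup>2x\<close>. We need such an \<open>x \<in> W(K)\<close> with
  zeroth component \<open>t\<^sup>-\<^sup>1\<close> and \<open>a \<in> W(k[[t]])\<close>.

  With \<open>x = S z\<close> and \<open>a = [t]\<^sup>p\<^sup>-\<^sup>1 (1 + b)\<close> the equation becomes
  \<open>z - \<sigma>z = b \<sigma>z + p\<^sup>5 S\<^sup>m \<sigma>\<^sup>2z\<close> with \<open>m = p\<^sup>2 - 1\<close>. Expand \<open>z\<close> and \<open>b\<close> in powers of \<open>p\<^sup>5\<close>. Over the
  perfection of \<open>K\<close> the coefficients are integral combinations of powers of \<open>S\<close> with exponents in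
  \<open>\<int>[1/p]\<close>, and at each order one has to solve \<open>z\<^sub>i - \<sigma>z\<^sub>i = b\<^sub>i + y\<^sub>i\<close> with \<open>y\<^sub>i\<close> given. Modulo
  \<open>\<sigma> - 1\<close> one may replace every power of \<open>S\<close> in \<open>y\<^sub>i\<close> by its \<open>p\<^sup>r\<close>-th root, which makes its pole so
  small that \<open>[t]\<^sup>p\<^sup>-\<^sup>1 b\<^sub>i\<close> becomes integral. The poles of \<open>y\<^sub>i\<close> grow exponentially in \<open>i\<close>, but a
  monomial with pole \<open>m / p\<^sup>d\<close> at order \<open>i\<close> satisfies \<open>m \<le> p\<^sup>L\<close> and \<open>d \<le> L\<close> for \<open>L = 5 i - 2\<close>, so
  denominators up to \<open>p\<^sup>L\<close> suffice; as \<open>p\<^sup>L \<sigma>\<^sup>-\<^sup>L = V\<^sup>L\<close>, the factor \<open>p\<^sup>5\<^sup>i\<close> brings everything back into \<open>W(K)\<close>.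
\<close>

section \<open>Homomorphisms and integer polynomials\<close>

locale unital_hom =
  fixes h :: "'a::comm_ring_1 \<Rightarrow> 'b::comm_ring_1"
  assumes hom_one [simp]: "h 1 = 1"
    and hom_add: "h (x + y) = h x + h y"
    and hom_mult: "h (x * y) = h x * h y"
begin

lemma hom_zero [simp]: "h 0 = 0"
  using hom_add[of 0 0] by simp

lemma hom_minus: "h (- x) = - h x"
  using hom_add[of x "- x"] by (simp add: eq_neg_iff_add_eq_0 add.commute)

lemma hom_diff: "h (x - y) = h x - h y"
  using hom_add[of x "- y"] by (simp add: hom_minus)

lemma hom_power: "h (x ^ n) = h x ^ n"
  by (induction n) (simp_all add: hom_mult)

lemma hom_of_nat: "h (of_nat n) = of_nat n"
  by (induction n) (simp_all add: hom_add)

lemma hom_sum: "h (\<Sum>i\<in>A. g i) = (\<Sum>i\<in>A. h (g i))"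
  by (induction A rule: infinite_finite_induct) (simp_all add: hom_add)

lemma hom_prod: "h (\<Prod>i\<in>A. g i) = (\<Prod>i\<in>A. h (g i))"
  by (induction A rule: infinite_finite_induct) (simp_all add: hom_mult)

lemma hom_ghost: "h (ghost p x n) = ghost p (\<lambda>i. h (x i)) n"
  by (simp add: ghost_def hom_sum hom_mult hom_power hom_of_nat)

end

text \<open>The additive extension of \<open>g\<close> to formal integer sums. It serves twice: an
  integer polynomial is a formal sum of monomials, and a representative of a tensor is a formal sum
  of pairs.\<close>

definition frag_eval :: "('b \<Rightarrow> 'a::comm_ring_1) \<Rightarrow> ('b \<Rightarrow>\<^sub>0 int) \<Rightarrow> 'a" where
  "frag_eval g a = (\<Sum>b\<in>Poly_Mapping.keys a. of_int (Poly_Mapping.lookup a b) * g b)"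

lemma frag_eval_superset:
  assumes "finite A" "Poly_Mapping.keys a \<subseteq> A"
  shows "frag_eval g a = (\<Sum>b\<in>A. of_int (Poly_Mapping.lookup a b) * g b)"
  unfolding frag_eval_def
  by (rule sum.mono_neutral_left) (use assms in \<open>auto simp: in_keys_iff\<close>)

lemma frag_eval_add: "frag_eval g (a + b) = frag_eval g a + frag_eval g b"
proof -
  let ?A = "Poly_Mapping.keys a \<union> Poly_Mapping.keys b"
  have "Poly_Mapping.keys (a + b) \<subseteq> ?A"
    by (rule Poly_Mapping.keys_add)
  then show ?thesis
    by (simp add: frag_eval_superset[of ?A] lookup_add ring_distribs sum.distrib)
qed

lemma frag_eval_zero [simp]: "frag_eval g 0 = 0"
  by (simp add: frag_eval_def)

lemma frag_eval_diff: "frag_eval g (a - b) = frag_eval g a - frag_eval g b"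
  using frag_eval_add[of g "a - b" b] by simp

lemma frag_eval_frag_of: "frag_eval g (frag_of b) = g b"
  by (simp add: frag_eval_def)

definition monom_eval :: "('v \<Rightarrow> 'a::comm_ring_1) \<Rightarrow> ('v \<Rightarrow>\<^sub>0 nat) \<Rightarrow> 'a" where
  "monom_eval f m = (\<Prod>v\<in>Poly_Mapping.keys m. f v ^ Poly_Mapping.lookup m v)"

lemma monom_eval_superset:
  assumes "finite A" "Poly_Mapping.keys m \<subseteq> A"
  shows "monom_eval f m = (\<Prod>v\<in>A. f v ^ Poly_Mapping.lookup m v)"
  unfolding monom_eval_def
  by (rule prod.mono_neutral_left) (use assms in \<open>auto simp: in_keys_iff\<close>)

lemma monom_eval_add: "monom_eval f (m + m') = monom_eval f m * monom_eval f m'"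
proof -
  let ?A = "Poly_Mapping.keys m \<union> Poly_Mapping.keys m'"
  have "Poly_Mapping.keys (m + m') \<subseteq> ?A"
    by (rule Poly_Mapping.keys_add)
  then show ?thesis
    by (simp add: monom_eval_superset[of ?A] lookup_add power_add prod.distrib)
qed

lemma xy_eval_eq: "xy_eval f = frag_eval (monom_eval f)"
  by (rule ext) (simp add: xy_eval_def frag_eval_def monom_eval_def)

lemma xy_eval_add: "xy_eval f (P + Q) = xy_eval f P + xy_eval f Q"
  by (simp add: xy_eval_eq frag_eval_add)

lemma xy_eval_zero [simp]: "xy_eval f 0 = 0"
  by (simp add: xy_eval_eq)

lemma xy_eval_diff: "xy_eval f (P - Q) = xy_eval f P - xy_eval f Q"
  by (simp add: xy_eval_eq frag_eval_diff)

lemma xy_eval_frag_of: "xy_eval f (frag_of m) = monom_eval f m"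
  unfolding xy_eval_eq by (rule frag_eval_frag_of)

lemma frag_of_mult: "frag_of m * frag_of m' = (frag_of (m + m') :: 'a::comm_monoid_add \<Rightarrow>\<^sub>0 int)"
  by (simp add: mult_single)

lemma xy_eval_mult: "xy_eval f (P * Q) = xy_eval f P * xy_eval f Q"
proof -
  have "xy_eval f (frag_of m * Q) = monom_eval f m * xy_eval f Q" for m
    by (induction Q rule: frag_induction[OF subset_UNIV])
      (simp_all add: frag_of_mult xy_eval_frag_of monom_eval_add right_diff_distrib xy_eval_diff)
  then show ?thesis
    by (induction P rule: frag_induction[OF subset_UNIV])
      (simp_all add: xy_eval_frag_of left_diff_distrib xy_eval_diff)
qed

lemma unital_hom_xy_eval: "unital_hom (xy_eval f)"
proof
  show "xy_eval f 1 = 1"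
    by (simp add: xy_eval_def lookup_one)
qed (simp_all add: xy_eval_add xy_eval_mult)

lemma xy_eval_var [simp]: "xy_eval f (xy_var v) = f v"
  by (simp add: xy_var_def xy_eval_def)

lemma (in unital_hom) hom_xy_eval: "h (xy_eval f P) = xy_eval (\<lambda>v. h (f v)) P"
proof -
  have *: "h (monom_eval f m) = monom_eval (\<lambda>v. h (f v)) m" for m :: "nat + nat \<Rightarrow>\<^sub>0 nat"
    by (simp add: monom_eval_def hom_prod hom_power)
  show ?thesis
    by (induction P rule: frag_induction[OF subset_UNIV])
      (simp_all add: xy_eval_frag_of xy_eval_diff hom_diff *)
qed

section \<open>Ghost components\<close>

lemma lookup_of_nat_mult:
  "Poly_Mapping.lookup (of_nat n * P) k = int n * Poly_Mapping.lookup (P :: 'a::monoid_add \<Rightarrow>\<^sub>0 int) k"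
  by (induction n) (simp_all add: lookup_add ring_distribs)

lemma of_nat_mult_cancel:
  fixes P Q :: xy_poly
  assumes "of_nat n * P = of_nat n * Q" "n > 0"
  shows "P = Q"
proof (rule poly_mapping_eqI)
  fix k
  have "int n * Poly_Mapping.lookup P k = int n * Poly_Mapping.lookup Q k"
    using assms(1) by (simp flip: lookup_of_nat_mult)
  then show "Poly_Mapping.lookup P k = Poly_Mapping.lookup Q k"
    using assms(2) by simp
qed

lemma prime_dvd_freshman:
  fixes x y :: "'a::comm_ring_1"
  assumes "prime p"
  shows "of_nat p dvd (x + y) ^ p - x ^ p - y ^ p"
proof -
  have p: "p > 1"
    using assms by (rule prime_gt_1_nat)
  have "{..p} = insert 0 (insert p {1..<p})"
    using p by auto
  then have "(x + y) ^ p - x ^ p - y ^ p = (\<Sum>k\<in>{1..<p}. of_nat (p choose k) * x ^ k * y ^ (p - k))"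
    using p by (simp add: binomial_ring)
  also have "of_nat p dvd \<dots>"
  proof (rule dvd_sum)
    fix k
    assume "k \<in> {1..<p}"
    then have "p dvd p choose k"
      using assms by (intro dvd_choose_prime) auto
    then have "(of_nat p :: 'a) dvd of_nat (p choose k)"
      by (auto simp: dvd_def)
    then show "of_nat p dvd of_nat (p choose k) * x ^ k * y ^ (p - k)"
      by (simp add: mult.assoc)
  qed
  finally show ?thesis .
qed

lemma dvd_power_diff:
  fixes x y :: "'a::comm_ring_1"
  assumes "a dvd x - y"
  shows "a dvd x ^ n - y ^ n"
  using assms by (simp add: power_diff_sumr2)

text \<open>Each \<open>p\<close>-th power gains one factor \<open>p\<close>:
  \<open>X ^ p - Y ^ p\<close> is \<open>X - Y\<close> times a sum of \<open>p\<close> terms, each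
  of which is congruent to \<open>Y ^ (p - 1)\<close> modulo \<open>p\<close> when \<open>X\<close>
  and \<open>Y\<close> are congruent modulo \<open>p\<close>.\<close>

lemma prime_power_dvd_power_diff:
  fixes x y :: "'a::comm_ring_1"
  assumes "of_nat p ^ Suc k dvd x - y"
  shows "of_nat p ^ (Suc k + m) dvd x ^ (p ^ m) - y ^ (p ^ m)"
proof (induction m)
  case (Suc m)
  define X Y where "X = x ^ (p ^ m)" and "Y = y ^ (p ^ m)"
  have XY: "of_nat p ^ (Suc k + m) dvd X - Y"
    using Suc by (simp add: X_def Y_def)
  have pXY: "of_nat p dvd X - Y"
    using XY by (meson dvd_trans dvd_power zero_less_Suc add_gr_0)
  have "of_nat p dvd (\<Sum>i<p. Y ^ (p - Suc i) * X ^ i)"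
  proof -
    have "(\<Sum>i<p. Y ^ (p - Suc i) * Y ^ i) = (\<Sum>i<p. Y ^ (p - 1))"
      by (rule sum.cong) (auto simp flip: power_add)
    then have "(\<Sum>i<p. Y ^ (p - Suc i) * X ^ i) =
        (\<Sum>i<p. Y ^ (p - Suc i) * (X ^ i - Y ^ i)) + of_nat p * Y ^ (p - 1)"
      by (simp add: right_diff_distrib sum_subtractf)
    moreover have "of_nat p dvd (\<Sum>i<p. Y ^ (p - Suc i) * (X ^ i - Y ^ i))"
      by (intro dvd_sum dvd_mult dvd_power_diff pXY)
    ultimately show ?thesis
      by simp
  qed
  then have "of_nat p ^ (Suc k + m) * of_nat p dvd (X - Y) * (\<Sum>i<p. Y ^ (p - Suc i) * X ^ i)"
    using XY by (rule mult_dvd_mono[rotated])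
  then have "of_nat p ^ (Suc k + Suc m) dvd X ^ p - Y ^ p"
    by (simp add: power_diff_sumr2 mult_ac)
  then show ?case
    by (simp add: X_def Y_def mult.commute flip: power_mult)
qed (use assms in simp)

lemma ghost_0: "ghost p x 0 = x 0"
  by (simp add: ghost_def)

text \<open>This recursion drives the inductions below: the newest component enters linearly, the
  earlier ones only through their \<open>p\<close>-th powers.\<close>

lemma ghost_Suc:
  "ghost p x (Suc n) = ghost p (\<lambda>i. x i ^ p) n + of_nat p ^ Suc n * x (Suc n)"
proof -
  have "of_nat p ^ i * x i ^ (p ^ (Suc n - i)) = of_nat p ^ i * (x i ^ p) ^ (p ^ (n - i))"
    if "i \<le> n" for i
    using that by (simp add: Suc_diff_le flip: power_mult)
  then show ?thesis
    by (simp add: ghost_def)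
qed

lemma ghost_cong: "(\<And>i. i \<le> n \<Longrightarrow> x i = y i) \<Longrightarrow> ghost p x n = ghost p y n"
  by (simp add: ghost_def)

text \<open>The \<open>i\<close>-th summand carries \<open>p ^ i\<close>, and raising to the power
  \<open>p ^ (n - i)\<close> adds \<open>n - i\<close> further factors.\<close>

lemma ghost_dvd_diff:
  assumes "\<And>i. i \<le> n \<Longrightarrow> of_nat p ^ Suc k dvd x i - y i"
  shows "of_nat p ^ (Suc k + n) dvd ghost p x n - ghost p y n"
proof -
  have "ghost p x n - ghost p y n = (\<Sum>i\<le>n. of_nat p ^ i * (x i ^ (p ^ (n - i)) - y i ^ (p ^ (n - i))))"
    by (simp add: ghost_def right_diff_distrib sum_subtractf)
  also have "of_nat p ^ (Suc k + n) dvd \<dots>"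
  proof (rule dvd_sum)
    fix i
    assume "i \<in> {..n}"
    then have i: "i \<le> n"
      by simp
    then have "of_nat p ^ i * of_nat p ^ (Suc k + (n - i)) dvd
        of_nat p ^ i * (x i ^ (p ^ (n - i)) - y i ^ (p ^ (n - i)))"
      by (intro mult_dvd_mono prime_power_dvd_power_diff assms) simp_all
    also have "of_nat p ^ i * of_nat p ^ (Suc k + (n - i)) = (of_nat p ^ (Suc k + n) :: 'a)"
      using i by (subst power_add[symmetric]) (simp del: power_Suc)
    finally show "of_nat p ^ (Suc k + n) dvd of_nat p ^ i * (x i ^ (p ^ (n - i)) - y i ^ (p ^ (n - i)))" .
  qed
  finally show ?thesis .
qed

text \<open>The ghost equations are triangular with leading coefficients \<open>p ^ n\<close>, which
  cancel because integer polynomials are torsion free.\<close>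

lemma ghost_eq_imp_eq:
  fixes x y :: "nat \<Rightarrow> xy_poly"
  assumes "p > 0" "\<And>i. i \<le> n \<Longrightarrow> ghost p x i = ghost p y i"
  shows "x n = y n"
  using assms(2)
proof (induction n rule: less_induct)
  case (less n)
  show ?case
  proof (cases n)
    case 0
    then show ?thesis
      using less.prems[of 0] by (simp add: ghost_0)
  next
    case (Suc m)
    have "ghost p (\<lambda>i. x i ^ p) m = ghost p (\<lambda>i. y i ^ p) m"
      by (rule ghost_cong) (use less Suc in simp)
    then have "of_nat (p ^ n) * x n = of_nat (p ^ n) * y n"
      using less.prems[of n] Suc by (simp add: ghost_Suc)
    then show ?thesis
      by (rule of_nat_mult_cancel) (use assms(1) in simp)
  qed
qed

lemma ghost_inject:
  fixes x y :: "nat \<Rightarrow> xy_poly"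
  shows "p > 0 \<Longrightarrow> (\<And>n. ghost p x n = ghost p y n) \<Longrightarrow> x = y"
  using ghost_eq_imp_eq[of p _ x y] by blast

text \<open>The previous induction made quantitative: components congruent modulo \<open>p\<close>
  have \<open>p\<close>-th powers congruent modulo \<open>p ^ 2\<close>, so the nonlinear parts of
  the \<open>n\<close>-th ghost components agree modulo \<open>p ^ (n + 1)\<close>, and cancelling
  \<open>p ^ n\<close> leaves one factor \<open>p\<close>.\<close>

lemma ghost_dvd_imp_dvd:
  fixes x y :: "nat \<Rightarrow> xy_poly"
  assumes "p > 0" "\<And>i. i \<le> n \<Longrightarrow> of_nat p ^ Suc i dvd ghost p x i - ghost p y i"
  shows "of_nat p dvd x n - y n"
  using assms(2)
proof (induction n rule: less_induct)
  case (less n)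
  show ?case
  proof (cases n)
    case 0
    then show ?thesis
      using less.prems[of 0] by (simp add: ghost_0)
  next
    case (Suc m)
    have "of_nat p ^ (Suc 1 + m) dvd ghost p (\<lambda>i. x i ^ p) m - ghost p (\<lambda>i. y i ^ p) m"
    proof (rule ghost_dvd_diff)
      fix i
      assume "i \<le> m"
      then have "of_nat p ^ Suc 0 dvd x i - y i"
        using less Suc by simp
      from prime_power_dvd_power_diff[OF this, of 1]
      show "of_nat p ^ Suc 1 dvd x i ^ p - y i ^ p"
        by simp
    qed
    moreover have "of_nat p ^ (Suc 1 + m) dvd ghost p x n - ghost p y n"
      using less.prems[of n] Suc by simp
    ultimately have "of_nat p ^ (Suc 1 + m) dvd
        (ghost p x n - ghost p y n) - (ghost p (\<lambda>i. x i ^ p) m - ghost p (\<lambda>i. y i ^ p) m)"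
      by (rule dvd_diff[rotated])
    also have "\<dots> = of_nat p ^ n * (x n - y n)"
      by (simp add: Suc ghost_Suc algebra_simps)
    finally obtain c where c: "of_nat p ^ n * (x n - y n) = of_nat p ^ (Suc 1 + m) * c"
      by (auto simp: dvd_def)
    then have "of_nat (p ^ n) * (x n - y n) = of_nat (p ^ n) * (of_nat p * c)"
      by (simp add: Suc mult_ac)
    then have "x n - y n = of_nat p * c"
      by (rule of_nat_mult_cancel) (use assms(1) in simp)
    then show ?thesis
      by simp
  qed
qed

section \<open>Dwork's congruences and the existence of the Witt polynomials\<close>

definition xy_frob :: "nat \<Rightarrow> xy_poly \<Rightarrow> xy_poly" where
  "xy_frob p = xy_eval (\<lambda>v. xy_var v ^ p)"

lemma unital_hom_xy_frob: "unital_hom (xy_frob p)"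
  unfolding xy_frob_def by (rule unital_hom_xy_eval)

lemma xy_var_power: "xy_var v ^ k = frag_of (Poly_Mapping.single v k)"
  by (induction k) (simp_all add: xy_var_def mult_single flip: single_add)

lemma frag_of_sum:
  "finite A \<Longrightarrow> (frag_of (\<Sum>v\<in>A. g v) :: 'a::comm_monoid_add \<Rightarrow>\<^sub>0 int) = (\<Prod>v\<in>A. frag_of (g v))"
  by (induction A rule: finite_induct) (simp_all flip: frag_of_mult)

lemma monom_eval_xy_var: "monom_eval xy_var m = frag_of m"
proof -
  have "m = (\<Sum>v\<in>Poly_Mapping.keys m. Poly_Mapping.single v (Poly_Mapping.lookup m v))"
    by (rule poly_mapping_eqI)
      (auto simp: lookup_sum lookup_single when_def in_keys_iff)
  then have "frag_of m = frag_of (\<Sum>v\<in>Poly_Mapping.keys m. Poly_Mapping.single v (Poly_Mapping.lookup m v))"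
    by (rule arg_cong)
  also have "\<dots> = (\<Prod>v\<in>Poly_Mapping.keys m. frag_of (Poly_Mapping.single v (Poly_Mapping.lookup m v)))"
    by (rule frag_of_sum) simp
  finally show ?thesis
    by (simp add: monom_eval_def xy_var_power)
qed

lemma power_commutes_twice: "(a ^ m) ^ n = (a ^ n) ^ (m :: nat)" for a :: "'a::monoid_mult"
  by (metis mult.commute power_mult)

text \<open>\<open>xy_frob\<close> lifts the Frobenius: it maps monomials exactly to their
  \<open>p\<close>-th powers, and additivity of the \<open>p\<close>-th power modulo
  \<open>p\<close> carries the congruence over to differences.\<close>

lemma xy_frob_dvd:
  assumes "prime p"
  shows "of_nat p dvd xy_frob p P - P ^ p"
proof (induction P rule: frag_induction[OF subset_UNIV])
  case 1
  then show ?case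
    using prime_gt_0_nat[OF assms] by (simp add: xy_frob_def zero_power)
next
  case (2 m)
  have "monom_eval (\<lambda>v. xy_var v ^ p) m = monom_eval xy_var m ^ p"
    unfolding monom_eval_def prod_power_distrib
    by (rule prod.cong) (simp_all only: power_commutes_twice)
  then show ?case
    by (simp add: xy_frob_def xy_eval_frag_of monom_eval_xy_var)
next
  case (3 P Q)
  interpret unital_hom "xy_frob p"
    by (rule unital_hom_xy_frob)
  have "of_nat p dvd P ^ p - (P - Q) ^ p - Q ^ p"
    using prime_dvd_freshman[OF assms, of "P - Q" Q] by simp
  then have "of_nat p dvd (xy_frob p P - P ^ p) - (xy_frob p Q - Q ^ p) + (P ^ p - (P - Q) ^ p - Q ^ p)"
    by (rule dvd_add[OF dvd_diff[OF 3]])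
  then show ?case
    by (simp add: hom_diff algebra_simps)
qed

text \<open>Dwork's condition characterises the sequences of ghost components
  (\<open>dwork_seq_ghost\<close>, \<open>dwork_lemma\<close>). As it is stable under ring
  operations, sums, products and negatives of ghost sequences are ghost sequences again.\<close>

definition dwork_seq :: "nat \<Rightarrow> (nat \<Rightarrow> xy_poly) \<Rightarrow> bool" where
  "dwork_seq p w \<longleftrightarrow> (\<forall>n. of_nat p ^ Suc n dvd xy_frob p (w n) - w (Suc n))"

lemma xy_frob_ghost_dvd:
  assumes "prime p"
  shows "of_nat p ^ Suc n dvd xy_frob p (ghost p x n) - ghost p (\<lambda>i. x i ^ p) n"
proof -
  interpret unital_hom "xy_frob p"
    by (rule unital_hom_xy_frob)
  have "of_nat p ^ (Suc 0 + n) dvd ghost p (\<lambda>i. xy_frob p (x i)) n - ghost p (\<lambda>i. x i ^ p) n"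
    by (rule ghost_dvd_diff) (simp add: xy_frob_dvd[OF assms])
  then show ?thesis
    by (simp add: hom_ghost)
qed

lemma dwork_seq_ghost:
  assumes "prime p"
  shows "dwork_seq p (ghost p x)"
  unfolding dwork_seq_def
proof
  fix n
  have "of_nat p ^ Suc n dvd
      (xy_frob p (ghost p x n) - ghost p (\<lambda>i. x i ^ p) n) - of_nat p ^ Suc n * x (Suc n)"
    using xy_frob_ghost_dvd[OF assms] by (rule dvd_diff) simp
  then show "of_nat p ^ Suc n dvd xy_frob p (ghost p x n) - ghost p x (Suc n)"
    by (simp add: ghost_Suc algebra_simps)
qed

lemma dwork_seq_add: "dwork_seq p v \<Longrightarrow> dwork_seq p w \<Longrightarrow> dwork_seq p (\<lambda>n. v n + w n)"
  unfolding dwork_seq_def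
  by (simp add: unital_hom.hom_add[OF unital_hom_xy_frob] add_diff_add del: power_Suc)

lemma dwork_seq_minus: "dwork_seq p w \<Longrightarrow> dwork_seq p (\<lambda>n. - w n)"
  unfolding dwork_seq_def
  by (simp only: unital_hom.hom_minus[OF unital_hom_xy_frob] minus_diff_minus dvd_minus_iff simp_thms)

lemma dwork_seq_mult:
  assumes "dwork_seq p v" "dwork_seq p w"
  shows "dwork_seq p (\<lambda>n. v n * w n)"
  unfolding dwork_seq_def
proof
  fix n
  have "xy_frob p (v n * w n) - v (Suc n) * w (Suc n) =
      (xy_frob p (v n) - v (Suc n)) * xy_frob p (w n) + v (Suc n) * (xy_frob p (w n) - w (Suc n))"
    by (simp add: unital_hom.hom_mult[OF unital_hom_xy_frob] algebra_simps)
  then show "of_nat p ^ Suc n dvd xy_frob p (v n * w n) - v (Suc n) * w (Suc n)"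
    using assms unfolding dwork_seq_def by (metis dvd_add dvd_mult dvd_mult2)
qed

text \<open>The components are found one at a time. Both \<open>w (Suc n)\<close> and the nonlinear
  part \<open>ghost p (\<lambda>i. x i ^ p) n\<close> are congruent to
  \<open>xy_frob p (w n)\<close> modulo \<open>p ^ Suc n\<close>, so their difference is
  \<open>p ^ Suc n\<close> times the next component.\<close>

lemma dwork_lemma:
  assumes p: "prime p" and w: "dwork_seq p w"
  shows "\<exists>x. \<forall>n. ghost p x n = w n"
proof -
  have "\<exists>f. \<forall>n. (\<forall>i\<le>n. ghost p (f n) i = w i) \<and> (\<forall>i\<le>n. f (Suc n) i = f n i)"
  proof (rule dependent_nat_choice)
    show "\<exists>x. \<forall>i\<le>0. ghost p x i = w i"
      by (rule exI[of _ w]) (simp add: ghost_0)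
  next
    fix x n
    assume x: "\<forall>i\<le>n. ghost p x i = w i"
    have "of_nat p ^ Suc n dvd (xy_frob p (ghost p x n) - ghost p (\<lambda>i. x i ^ p) n) -
        (xy_frob p (w n) - w (Suc n))"
      by (rule dvd_diff[OF xy_frob_ghost_dvd[OF p] w[unfolded dwork_seq_def, rule_format]])
    then have "of_nat p ^ Suc n dvd w (Suc n) - ghost p (\<lambda>i. x i ^ p) n"
      using x by simp
    then obtain y where y: "w (Suc n) - ghost p (\<lambda>i. x i ^ p) n = of_nat p ^ Suc n * y"
      by (elim dvdE)
    let ?x = "x(Suc n := y)"
    have "ghost p ?x i = w i" if "i \<le> Suc n" for i
    proof (cases "i = Suc n")
      case True
      have "ghost p (\<lambda>i. ?x i ^ p) n = ghost p (\<lambda>i. x i ^ p) n"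
        by (rule ghost_cong) simp
      then show ?thesis
        using True y by (simp add: ghost_Suc algebra_simps)
    next
      case False
      then have "ghost p ?x i = ghost p x i"
        using that by (intro ghost_cong) auto
      then show ?thesis
        using x that False by simp
    qed
    then show "\<exists>y. (\<forall>i\<le>Suc n. ghost p y i = w i) \<and> (\<forall>i\<le>n. y i = x i)"
      by (intro exI[of _ ?x]) simp
  qed
  then obtain f where f: "\<And>n. ghost p (f n) n = w n" and step: "\<And>n i. i \<le> n \<Longrightarrow> f (Suc n) i = f n i"
    by blast
  \<comment> \<open>Entries are never changed once they are fixed, so the diagonal is the limit of
    the approximations.\<close>
  have diag: "f n i = f i i" if "i \<le> n" for n i
    using that by (induction n rule: dec_induct) (simp_all add: step)
  have "ghost p (\<lambda>i. f i i) n = w n" for n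
    unfolding f[symmetric] by (rule ghost_cong) (rule diag[symmetric])
  then show ?thesis
    by blast
qed

text \<open>Turns the definite descriptions of the Witt polynomials into usable equations.\<close>

lemma ex1_ghost:
  assumes "prime p" "dwork_seq p w"
  shows "\<exists>!x. \<forall>n. ghost p x n = w n"
proof -
  obtain x where x: "\<forall>n. ghost p x n = w n"
    using dwork_lemma[OF assms] by blast
  show ?thesis
  proof (rule ex1I)
    show "\<forall>n. ghost p x n = w n"
      by (rule x)
  next
    fix y
    assume "\<forall>n. ghost p y n = w n"
    with x show "y = x"
      by (intro ghost_inject[OF prime_gt_0_nat[OF assms(1)]]) simp
  qed
qed

section \<open>The ring of Witt vectors\<close>

definition witt_add :: "nat \<Rightarrow> (nat \<Rightarrow> 'a::comm_ring_1) \<Rightarrow> (nat \<Rightarrow> 'a) \<Rightarrow> nat \<Rightarrow> 'a" where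
  "witt_add p x y = (\<lambda>n. xy_eval (case_sum x y) (witt_sum_poly p n))"

definition witt_mult :: "nat \<Rightarrow> (nat \<Rightarrow> 'a::comm_ring_1) \<Rightarrow> (nat \<Rightarrow> 'a) \<Rightarrow> nat \<Rightarrow> 'a" where
  "witt_mult p x y = (\<lambda>n. xy_eval (case_sum x y) (witt_prod_poly p n))"

text \<open>Negation gets its own polynomials because it is not componentwise for
  \<open>p = 2\<close>. Only the first family of variables matters, so \<open>witt_neg\<close> fills
  the second one with a copy of \<open>x\<close>.\<close>

definition witt_neg_poly :: "nat \<Rightarrow> nat \<Rightarrow> xy_poly" where
  "witt_neg_poly p = (THE S. \<forall>n. ghost p S n = - ghost p (\<lambda>i. xy_var (Inl i)) n)"

definition witt_neg :: "nat \<Rightarrow> (nat \<Rightarrow> 'a::comm_ring_1) \<Rightarrow> nat \<Rightarrow> 'a" where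
  "witt_neg p x = (\<lambda>n. xy_eval (case_sum x x) (witt_neg_poly p n))"

definition witt_one :: "nat \<Rightarrow> 'a::comm_ring_1" where
  "witt_one = (\<lambda>n. if n = 0 then 1 else 0)"

definition witt_shift :: "(nat \<Rightarrow> 'a::comm_ring_1) \<Rightarrow> nat \<Rightarrow> 'a" where
  "witt_shift x = case_nat 0 x"

definition witt_teich :: "'a::comm_ring_1 \<Rightarrow> nat \<Rightarrow> 'a" where
  "witt_teich a = (\<lambda>n. if n = 0 then a else 0)"

lemma ghost_xy_eval: "ghost p (\<lambda>i. xy_eval f (S i)) n = xy_eval f (ghost p S n)"
  by (simp add: unital_hom.hom_ghost[OF unital_hom_xy_eval])

context
  fixes p :: nat
  assumes p: "prime p"
begin

lemma ghost_witt_add: "ghost p (witt_add p x y) n = ghost p x n + ghost p y n"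
proof -
  have "\<forall>n. ghost p (witt_sum_poly p) n =
     ghost p (\<lambda>i. xy_var (Inl i)) n + ghost p (\<lambda>i. xy_var (Inr i)) n"
    unfolding witt_sum_poly_def
    by (rule theI'[OF ex1_ghost[OF p dwork_seq_add[OF dwork_seq_ghost[OF p] dwork_seq_ghost[OF p]]]])
  then show ?thesis
    using ghost_xy_eval[of p "case_sum x y" "\<lambda>i. xy_var (Inl i)" n]
      ghost_xy_eval[of p "case_sum x y" "\<lambda>i. xy_var (Inr i)" n]
    by (simp add: witt_add_def ghost_xy_eval[of _ _ "witt_sum_poly p"] unital_hom.hom_add[OF unital_hom_xy_eval])
qed

lemma ghost_witt_mult: "ghost p (witt_mult p x y) n = ghost p x n * ghost p y n"
proof -
  have "\<forall>n. ghost p (witt_prod_poly p) n =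
     ghost p (\<lambda>i. xy_var (Inl i)) n * ghost p (\<lambda>i. xy_var (Inr i)) n"
    unfolding witt_prod_poly_def
    by (rule theI'[OF ex1_ghost[OF p dwork_seq_mult[OF dwork_seq_ghost[OF p] dwork_seq_ghost[OF p]]]])
  then show ?thesis
    using ghost_xy_eval[of p "case_sum x y" "\<lambda>i. xy_var (Inl i)" n]
      ghost_xy_eval[of p "case_sum x y" "\<lambda>i. xy_var (Inr i)" n]
    by (simp add: witt_mult_def ghost_xy_eval[of _ _ "witt_prod_poly p"] unital_hom.hom_mult[OF unital_hom_xy_eval])
qed

lemma ghost_witt_neg: "ghost p (witt_neg p x) n = - ghost p x n"
proof -
  have "\<forall>n. ghost p (witt_neg_poly p) n = - ghost p (\<lambda>i. xy_var (Inl i)) n"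
    unfolding witt_neg_poly_def
    by (rule theI'[OF ex1_ghost[OF p dwork_seq_minus[OF dwork_seq_ghost[OF p]]]])
  then show ?thesis
    using ghost_xy_eval[of p "case_sum x x" "\<lambda>i. xy_var (Inl i)" n]
    by (simp add: witt_neg_def ghost_xy_eval[of _ _ "witt_neg_poly p"] unital_hom.hom_minus[OF unital_hom_xy_eval])
qed

lemma ghost_witt_shift:
  "ghost p (witt_shift x) n = (case n of 0 \<Rightarrow> 0 | Suc m \<Rightarrow> of_nat p * ghost p x m)"
proof (cases n)
  case (Suc m)
  then show ?thesis
    using p by (simp add: ghost_def witt_shift_def sum.atMost_Suc_shift sum_distrib_left
      mult.assoc prime_gt_0_nat zero_power del: sum.atMost_Suc)
qed (simp add: ghost_def witt_shift_def)

lemma ghost_witt_teich: "ghost p (witt_teich a) n = a ^ (p ^ n)"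
proof -
  have "{..n} = insert 0 {1..n}"
    by auto
  then show ?thesis
    using p by (simp add: ghost_def witt_teich_def prime_gt_0_nat zero_power)
qed

lemma ghost_witt_one: "ghost p witt_one n = 1"
  using ghost_witt_teich[of 1 n] by (simp add: witt_teich_def witt_one_def)

lemma ghost_witt_zero: "ghost p (\<lambda>_. 0) n = 0"
  using p by (simp add: ghost_def prime_gt_0_nat zero_power)

end

context unital_hom
begin

lemma hom_case_sum: "(\<lambda>v. h (case_sum x y v)) = case_sum (\<lambda>i. h (x i)) (\<lambda>i. h (y i))"
  by (auto split: sum.split)

lemma hom_witt_add: "h (witt_add p x y n) = witt_add p (\<lambda>i. h (x i)) (\<lambda>i. h (y i)) n"
  by (simp add: witt_add_def hom_xy_eval hom_case_sum)

lemma hom_witt_mult: "h (witt_mult p x y n) = witt_mult p (\<lambda>i. h (x i)) (\<lambda>i. h (y i)) n"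
  by (simp add: witt_mult_def hom_xy_eval hom_case_sum)

lemma hom_witt_neg: "h (witt_neg p x n) = witt_neg p (\<lambda>i. h (x i)) n"
  by (simp add: witt_neg_def hom_xy_eval hom_case_sum)

lemma hom_witt_one: "h (witt_one n) = witt_one n"
  by (simp add: witt_one_def)

lemma hom_witt_shift: "h (witt_shift x n) = witt_shift (\<lambda>i. h (x i)) n"
  by (simp add: witt_shift_def split: nat.split)

lemma hom_witt_teich: "h (witt_teich a n) = witt_teich (h a) n"
  by (simp add: witt_teich_def)

lemmas hom_witt = hom_witt_add hom_witt_mult hom_witt_neg hom_witt_one hom_witt_shift hom_witt_teich

end

text \<open>Any three Witt vectors are images of Witt vectors over the torsion-free ring of integer
  polynomials, over which ghost components determine a Witt vector.\<close>

lemma witt_lift: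
  fixes x y z :: "nat \<Rightarrow> 'a::comm_ring_1"
  obtains f X Y Z where "x = (\<lambda>i. xy_eval f (X i))" "y = (\<lambda>i. xy_eval f (Y i))"
    "z = (\<lambda>i. xy_eval f (Z i))"
proof
  \<comment> \<open>Two of the three vectors share the \<open>Inl\<close> variables, at the even and
    the odd positions.\<close>
  let ?f = "case_sum (\<lambda>i. if even i then x (i div 2) else y (i div 2)) z"
  show "x = (\<lambda>i. xy_eval ?f (xy_var (Inl (2 * i))))" "y = (\<lambda>i. xy_eval ?f (xy_var (Inl (2 * i + 1))))"
    "z = (\<lambda>i. xy_eval ?f (xy_var (Inr i)))"
    by simp_all
qed

lemmas xy_eval_witt = unital_hom.hom_witt[OF unital_hom_xy_eval]
lemmas ghost_witt = ghost_witt_add ghost_witt_mult ghost_witt_neg ghost_witt_one ghost_witt_zero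
  ghost_witt_shift ghost_witt_teich

context
  fixes p :: nat
  assumes p: "prime p"
begin

lemma witt_eqI:
  assumes "\<And>n. ghost p X n = ghost p Y n"
  shows "(\<lambda>i. xy_eval f (X i)) = (\<lambda>i. xy_eval f (Y i))"
  using ghost_inject[OF prime_gt_0_nat[OF p] assms] by simp

text \<open>Some identities, such as \<open>p = V 1\<close>, fail over the integer polynomials and
  hold only after reduction modulo \<open>p\<close>. For them it suffices to compare the
  \<open>n\<close>-th ghost components modulo \<open>p ^ (n + 1)\<close>.\<close>

lemma witt_eqI_char:
  fixes f :: "nat + nat \<Rightarrow> 'a::comm_ring_1"
  assumes "(of_nat p :: 'a) = 0" and "\<And>n. of_nat p ^ Suc n dvd ghost p X n - ghost p Y n"
  shows "(\<lambda>i. xy_eval f (X i)) = (\<lambda>i. xy_eval f (Y i))"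
proof
  fix i
  interpret unital_hom "xy_eval f"
    by (rule unital_hom_xy_eval)
  have "of_nat p dvd X i - Y i"
    using prime_gt_0_nat[OF p] assms(2) by (rule ghost_dvd_imp_dvd)
  then obtain c where "X i - Y i = of_nat p * c"
    by (elim dvdE)
  then have "xy_eval f (X i - Y i) = 0"
    using assms(1) by (simp add: hom_mult hom_of_nat)
  then show "xy_eval f (X i) = xy_eval f (Y i)"
    by (simp add: hom_diff)
qed

lemma witt_add_assoc: "witt_add p (witt_add p x y) z = witt_add p x (witt_add p y z)"
proof -
  obtain f X Y Z where "x = (\<lambda>i. xy_eval f (X i))" "y = (\<lambda>i. xy_eval f (Y i))" "z = (\<lambda>i. xy_eval f (Z i))"
    by (rule witt_lift)
  then show ?thesis
    using witt_eqI[of "witt_add p (witt_add p X Y) Z" "witt_add p X (witt_add p Y Z)" f]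
    by (simp add: xy_eval_witt ghost_witt p)
qed

lemma witt_mult_assoc: "witt_mult p (witt_mult p x y) z = witt_mult p x (witt_mult p y z)"
proof -
  obtain f X Y Z where "x = (\<lambda>i. xy_eval f (X i))" "y = (\<lambda>i. xy_eval f (Y i))" "z = (\<lambda>i. xy_eval f (Z i))"
    by (rule witt_lift)
  then show ?thesis
    using witt_eqI[of "witt_mult p (witt_mult p X Y) Z" "witt_mult p X (witt_mult p Y Z)" f]
    by (simp add: xy_eval_witt ghost_witt p mult.assoc)
qed

lemma witt_distrib: "witt_mult p (witt_add p x y) z = witt_add p (witt_mult p x z) (witt_mult p y z)"
proof -
  obtain f X Y Z where "x = (\<lambda>i. xy_eval f (X i))" "y = (\<lambda>i. xy_eval f (Y i))" "z = (\<lambda>i. xy_eval f (Z i))"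
    by (rule witt_lift)
  then show ?thesis
    using witt_eqI[of "witt_mult p (witt_add p X Y) Z" "witt_add p (witt_mult p X Z) (witt_mult p Y Z)" f]
    by (simp add: xy_eval_witt ghost_witt p ring_distribs)
qed

lemma witt_add_commute: "witt_add p x y = witt_add p y x"
proof -
  obtain f X Y Z where "x = (\<lambda>i. xy_eval f (X i))" "y = (\<lambda>i. xy_eval f (Y i))" "x = (\<lambda>i. xy_eval f (Z i))"
    by (rule witt_lift)
  then show ?thesis
    using witt_eqI[of "witt_add p X Y" "witt_add p Y X" f]
    by (simp add: xy_eval_witt ghost_witt p add.commute)
qed

lemma witt_mult_commute: "witt_mult p x y = witt_mult p y x"
proof -
  obtain f X Y Z where "x = (\<lambda>i. xy_eval f (X i))" "y = (\<lambda>i. xy_eval f (Y i))" "x = (\<lambda>i. xy_eval f (Z i))"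
    by (rule witt_lift)
  then show ?thesis
    using witt_eqI[of "witt_mult p X Y" "witt_mult p Y X" f]
    by (simp add: xy_eval_witt ghost_witt p mult.commute)
qed

lemma witt_add_zero: "witt_add p (\<lambda>_. 0) x = x"
proof -
  obtain f X Y Z where "x = (\<lambda>i. xy_eval f (X i))" "x = (\<lambda>i. xy_eval f (Y i))" "x = (\<lambda>i. xy_eval f (Z i))"
    by (rule witt_lift)
  then show ?thesis
    using witt_eqI[of "witt_add p (\<lambda>_. 0) X" X f]
    by (simp add: xy_eval_witt ghost_witt p)
qed

lemma witt_mult_one: "witt_mult p witt_one x = x"
proof -
  obtain f X Y Z where "x = (\<lambda>i. xy_eval f (X i))" "x = (\<lambda>i. xy_eval f (Y i))" "x = (\<lambda>i. xy_eval f (Z i))"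
    by (rule witt_lift)
  then show ?thesis
    using witt_eqI[of "witt_mult p witt_one X" X f]
    by (simp add: xy_eval_witt ghost_witt p)
qed

lemma witt_add_neg: "witt_add p (witt_neg p x) x = (\<lambda>_. 0)"
proof -
  obtain f X Y Z where "x = (\<lambda>i. xy_eval f (X i))" "x = (\<lambda>i. xy_eval f (Y i))" "x = (\<lambda>i. xy_eval f (Z i))"
    by (rule witt_lift)
  then show ?thesis
    using witt_eqI[of "witt_add p (witt_neg p X) X" "\<lambda>_. 0" f]
    by (simp add: xy_eval_witt ghost_witt p)
qed

lemma witt_shift_add: "witt_shift (witt_add p x y) = witt_add p (witt_shift x) (witt_shift y)"
proof -
  obtain f X Y Z where "x = (\<lambda>i. xy_eval f (X i))" "y = (\<lambda>i. xy_eval f (Y i))" "x = (\<lambda>i. xy_eval f (Z i))"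
    by (rule witt_lift)
  then show ?thesis
    using witt_eqI[of "witt_shift (witt_add p X Y)" "witt_add p (witt_shift X) (witt_shift Y)" f]
    by (simp add: xy_eval_witt ghost_witt p ring_distribs split: nat.split)
qed

lemma witt_teich_mult: "witt_teich (a * b) = witt_mult p (witt_teich a) (witt_teich b)"
proof -
  let ?f = "case_sum (\<lambda>_. a) (\<lambda>_. b)" and ?X = "xy_var (Inl 0)" and ?Y = "xy_var (Inr 0)"
  show ?thesis
    using witt_eqI[of "witt_teich (?X * ?Y)" "witt_mult p (witt_teich ?X) (witt_teich ?Y)" ?f]
    by (simp add: xy_eval_witt ghost_witt p power_mult_distrib unital_hom.hom_mult[OF unital_hom_xy_eval])
qed

lemma witt_eq_teich_plus_shift: "x = witt_add p (witt_teich (x 0)) (witt_shift (\<lambda>i. x (Suc i)))"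
proof -
  obtain f X Y Z where x: "x = (\<lambda>i. xy_eval f (X i))" "x = (\<lambda>i. xy_eval f (Y i))" "x = (\<lambda>i. xy_eval f (Z i))"
    by (rule witt_lift)
  have "ghost p X n = X 0 ^ (p ^ n) + (case n of 0 \<Rightarrow> 0 | Suc m \<Rightarrow> of_nat p * ghost p (\<lambda>i. X (Suc i)) m)" for n
    by (cases n) (simp_all add: ghost_def sum.atMost_Suc_shift sum_distrib_left mult.assoc
      del: sum.atMost_Suc)
  then have "(\<lambda>i. xy_eval f (X i)) =
      (\<lambda>i. xy_eval f (witt_add p (witt_teich (X 0)) (witt_shift (\<lambda>i. X (Suc i))) i))"
    by (intro witt_eqI) (simp only: ghost_witt p)
  then show ?thesis
    unfolding x(1) by (simp only: xy_eval_witt)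
qed

text \<open>The projection formula \<open>x * V y = V (\<sigma> x * y)\<close>. In degree
  \<open>Suc m\<close> the two ghost components differ by the linear term of
  \<open>ghost p x (Suc m)\<close> times \<open>p * ghost p y m\<close>, which is divisible by
  \<open>p ^ (m + 2)\<close>.\<close>

lemma witt_mult_shift:
  fixes x y :: "nat \<Rightarrow> 'a::comm_ring_1"
  assumes "(of_nat p :: 'a) = 0"
  shows "witt_mult p x (witt_shift y) = witt_shift (witt_mult p (\<lambda>i. x i ^ p) y)"
proof -
  obtain f X Y Z where "x = (\<lambda>i. xy_eval f (X i))" "y = (\<lambda>i. xy_eval f (Y i))" "x = (\<lambda>i. xy_eval f (Z i))"
    by (rule witt_lift)
  moreover have "of_nat p ^ Suc n dvd ghost p (witt_mult p X (witt_shift Y)) n -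
      ghost p (witt_shift (witt_mult p (\<lambda>i. X i ^ p) Y)) n" for n
  proof (cases n)
    case (Suc m)
    have "ghost p (witt_mult p X (witt_shift Y)) n - ghost p (witt_shift (witt_mult p (\<lambda>i. X i ^ p) Y)) n =
        of_nat p ^ Suc n * (X n * ghost p Y m)"
      by (simp add: Suc ghost_witt p ghost_Suc[of p X] algebra_simps)
    then show ?thesis
      by simp
  qed (simp add: ghost_witt p)
  ultimately show ?thesis
    using witt_eqI_char[OF assms, of "witt_mult p X (witt_shift Y)" "witt_shift (witt_mult p (\<lambda>i. X i ^ p) Y)" f]
    by (simp add: xy_eval_witt unital_hom.hom_power[OF unital_hom_xy_eval])
qed

primrec witt_nat :: "nat \<Rightarrow> nat \<Rightarrow> 'a::comm_ring_1" where
  "witt_nat 0 = (\<lambda>_. 0)"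
| "witt_nat (Suc k) = witt_add p witt_one (witt_nat k)"

text \<open>The ghost components of \<open>p\<close> and of \<open>V 1\<close> differ only in degree
  0, where they are \<open>p\<close> and 0.\<close>

lemma witt_nat_prime:
  assumes "(of_nat p :: 'a::comm_ring_1) = 0"
  shows "witt_nat p = (witt_shift witt_one :: nat \<Rightarrow> 'a)"
proof -
  have "xy_eval f (witt_nat k i) = witt_nat k i" for f :: "nat + nat \<Rightarrow> 'a" and k i
    by (induction k arbitrary: i) (simp_all add: xy_eval_witt)
  moreover have g: "ghost p (witt_nat k :: nat \<Rightarrow> xy_poly) n = of_nat k" for k n
    by (induction k) (simp_all add: ghost_witt p)
  have "of_nat p ^ Suc n dvd ghost p (witt_nat p) n - ghost p (witt_shift witt_one :: nat \<Rightarrow> xy_poly) n" for n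
    by (cases n) (simp_all add: ghost_witt p g)
  ultimately show ?thesis
    using witt_eqI_char[OF assms, of "witt_nat p" "witt_shift witt_one" "\<lambda>_. 0"]
    by (simp add: xy_eval_witt)
qed

end

section \<open>Verschiebung, Frobenius and completeness\<close>

text \<open>A copy of the sequences that can be an instance of \<open>comm_ring_1\<close>, so that
  computations run in a ring type; the record \<open>witt_ring\<close> acts on the bare sequences
  and is rejoined through \<open>coords\<close> and \<open>Witt\<close>.\<close>

typedef 'a witt_vec = "UNIV :: (nat \<Rightarrow> 'a) set"
  morphisms coords Witt ..

lemma coords_Witt [simp]: "coords (Witt x) = x"
  by (rule Witt_inverse) simp

lemmas Witt_coords [simp] = coords_inverse

lemma witt_vec_eqI: "(\<And>i. coords x i = coords y i) \<Longrightarrow> x = y"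
  by (simp add: coords_inject[symmetric] fun_eq_iff)

text \<open>The prime is read off the coefficient ring; the value 2 in the junk case merely makes the
  Witt vectors over every commutative ring a commutative ring.\<close>

definition wprime :: "'a::comm_ring_1 itself \<Rightarrow> nat" where
  "wprime _ = (if prime CHAR('a) then CHAR('a) else 2)"

lemma prime_wprime: "prime (wprime TYPE('a::comm_ring_1))"
  by (simp add: wprime_def)

instantiation witt_vec :: (comm_ring_1) comm_ring_1
begin

definition "0 = Witt (\<lambda>_. 0)"
definition "1 = Witt witt_one"
definition "x + y = Witt (witt_add (wprime TYPE('a)) (coords x) (coords y))"
definition "x * y = Witt (witt_mult (wprime TYPE('a)) (coords x) (coords y))"
definition "- x = Witt (witt_neg (wprime TYPE('a)) (coords x))"
definition "x - y = x + - (y :: 'a witt_vec)"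

instance
proof
  fix x y z :: "'a witt_vec"
  note p = prime_wprime[where 'a = 'a]
  note defs = zero_witt_vec_def one_witt_vec_def plus_witt_vec_def times_witt_vec_def
    uminus_witt_vec_def minus_witt_vec_def
  show "x * y * z = x * (y * z)" "x + y + z = x + (y + z)" "(x + y) * z = x * z + y * z"
    "0 + x = x" "1 * x = x" "- x + x = 0" "x - y = x + - y"
    by (simp_all add: defs witt_mult_assoc p witt_add_assoc witt_distrib witt_add_zero witt_mult_one witt_add_neg)
  show "x * y = y * x"
    using witt_mult_commute[OF p, of "coords x" "coords y"] by (simp add: defs)
  show "x + y = y + x"
    using witt_add_commute[OF p, of "coords x" "coords y"] by (simp add: defs)
  show "(0 :: 'a witt_vec) \<noteq> 1"
    by (auto simp: defs Witt_inject witt_one_def fun_eq_iff)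
qed

end

lemma coords_zero [simp]: "coords 0 i = 0"
  by (simp add: zero_witt_vec_def)

lemma coords_one_0 [simp]: "coords 1 0 = 1"
  by (simp add: one_witt_vec_def witt_one_def)

lemma coords_add_0: "coords (x + y) 0 = coords x 0 + coords y 0"
  using ghost_witt_add[OF prime_wprime, of "coords x" "coords y" 0]
  by (simp add: plus_witt_vec_def ghost_0)

lemma coords_mult_0: "coords (x * y) 0 = coords x 0 * coords y 0"
  using ghost_witt_mult[OF prime_wprime, of "coords x" "coords y" 0]
  by (simp add: times_witt_vec_def ghost_0)

lemma coords_diff_0: "coords (x - y) 0 = coords x 0 - coords y 0"
  using coords_add_0[of "x - y" y] by simp

definition teich :: "'a::comm_ring_1 \<Rightarrow> 'a witt_vec" where
  "teich a = Witt (witt_teich a)"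

definition ver :: "'a::comm_ring_1 witt_vec \<Rightarrow> 'a witt_vec" where
  "ver x = Witt (witt_shift (coords x))"

definition frob :: "'a::comm_ring_1 witt_vec \<Rightarrow> 'a witt_vec" where
  "frob x = Witt (\<lambda>i. coords x i ^ CHAR('a))"

definition wmap :: "('a::comm_ring_1 \<Rightarrow> 'b::comm_ring_1) \<Rightarrow> 'a witt_vec \<Rightarrow> 'b witt_vec" where
  "wmap h x = Witt (\<lambda>i. h (coords x i))"

text \<open>The image of \<open>V ^ n\<close> (\<open>ver_ideal_iff\<close>); the Witt vectors are
  complete and separated for this filtration.\<close>

definition ver_ideal :: "nat \<Rightarrow> 'a::comm_ring_1 witt_vec set" where
  "ver_ideal n = {x. \<forall>i<n. coords x i = 0}"

lemma coords_teich_0 [simp]: "coords (teich a) 0 = a"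
  by (simp add: teich_def witt_teich_def)

lemma coords_ver: "coords (ver x) i = (case i of 0 \<Rightarrow> 0 | Suc j \<Rightarrow> coords x j)"
  by (simp add: ver_def witt_shift_def split: nat.split)

lemma coords_ver_pow: "coords ((ver ^^ n) x) i = (if i < n then 0 else coords x (i - n))"
proof (induction n arbitrary: i)
  case (Suc n)
  then show ?case
    by (cases i) (simp_all add: coords_ver)
qed simp

lemma teich_one [simp]: "teich 1 = 1"
  by (simp add: teich_def one_witt_vec_def witt_teich_def witt_one_def)

lemma teich_mult: "teich (a * b) = teich a * teich b"
  unfolding teich_def times_witt_vec_def coords_Witt
  by (rule arg_cong[OF witt_teich_mult[OF prime_wprime]])

lemma teich_power: "teich (a ^ n) = teich a ^ n"
  by (induction n) (simp_all add: teich_mult)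

lemma ver_add: "ver (x + y) = ver x + ver y"
  by (simp add: ver_def plus_witt_vec_def witt_shift_add[OF prime_wprime])

lemma ver_diff: "ver (x - y) = ver x - ver y"
  using ver_add[of "x - y" y] by simp

lemma ver_pow_add: "(ver ^^ n) (x + y) = (ver ^^ n) x + (ver ^^ n) y"
  by (induction n) (simp_all add: ver_add)

lemma witt_vec_decomp: "x = teich (coords x 0) + ver (Witt (\<lambda>i. coords x (Suc i)))"
  using witt_eq_teich_plus_shift[OF prime_wprime, of "coords x"]
  by (simp add: teich_def ver_def plus_witt_vec_def Witt_inject[symmetric] del: Witt_inject)

text \<open>Although subtraction is not componentwise, it respects the filtration: when the zeroth
  components agree, the Teichmueller parts cancel and the difference is \<open>V\<close> of the
  difference of the shifted vectors.\<close>

lemma diff_in_ver_ideal_iff: "x - y \<in> ver_ideal n \<longleftrightarrow> (\<forall>i<n. coords x i = coords y i)"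
proof (induction n arbitrary: x y)
  case (Suc n)
  define x' y' where "x' = Witt (\<lambda>i. coords x (Suc i))" and "y' = Witt (\<lambda>i. coords y (Suc i))"
  have x: "x = teich (coords x 0) + ver x'" and y: "y = teich (coords y 0) + ver y'"
    unfolding x'_def y'_def by (rule witt_vec_decomp)+
  show ?case
  proof (cases "coords x 0 = coords y 0")
    case True
    then have "x - y = ver (x' - y')"
      using arg_cong2[OF x y, of "(-)"] by (simp add: ver_diff)
    then have "x - y \<in> ver_ideal (Suc n) \<longleftrightarrow> x' - y' \<in> ver_ideal n"
      by (auto simp: ver_ideal_def coords_ver less_Suc_eq_0_disj)
    also have "\<dots> \<longleftrightarrow> (\<forall>i<n. coords x (Suc i) = coords y (Suc i))"
      by (simp add: Suc x'_def y'_def)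
    finally show ?thesis
      using True by (auto simp: less_Suc_eq_0_disj)
  next
    case False
    then show ?thesis
      by (auto simp: ver_ideal_def coords_diff_0)
  qed
qed (simp add: ver_ideal_def)

lemma ver_ideal_iff: "x \<in> ver_ideal n \<longleftrightarrow> (\<exists>y. x = (ver ^^ n) y)"
proof
  assume "x \<in> ver_ideal n"
  then have "x = (ver ^^ n) (Witt (\<lambda>i. coords x (i + n)))"
    by (intro witt_vec_eqI) (simp add: coords_ver_pow ver_ideal_def)
  then show "\<exists>y. x = (ver ^^ n) y" ..
qed (auto simp: ver_ideal_def coords_ver_pow)

lemma ver_pow_in_ver_ideal [simp]: "(ver ^^ n) x \<in> ver_ideal n"
  by (auto simp: ver_ideal_iff)

lemma ver_ideal_zero [simp]: "0 \<in> ver_ideal n"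
  by (simp add: ver_ideal_def)

lemma ver_ideal_add: "x \<in> ver_ideal n \<Longrightarrow> y \<in> ver_ideal n \<Longrightarrow> x + y \<in> ver_ideal n"
  by (auto simp: ver_ideal_iff simp flip: ver_pow_add)

lemma ver_ideal_minus:
  assumes "x \<in> ver_ideal n"
  shows "- x \<in> ver_ideal n"
  using assms diff_in_ver_ideal_iff[of 0 x n] by (auto simp: ver_ideal_def)

lemma ver_ideal_diff: "x \<in> ver_ideal n \<Longrightarrow> y \<in> ver_ideal n \<Longrightarrow> x - y \<in> ver_ideal n"
  using ver_ideal_add[of x n "- y"] by (simp add: ver_ideal_minus)

lemma ver_ideal_sum: "(\<And>i. i \<in> A \<Longrightarrow> g i \<in> ver_ideal n) \<Longrightarrow> sum g A \<in> ver_ideal n"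
  by (induction A rule: infinite_finite_induct) (auto intro: ver_ideal_add)

lemma ver_ideal_mono: "m \<le> n \<Longrightarrow> ver_ideal n \<subseteq> ver_ideal m"
  by (auto simp: ver_ideal_def)

lemma ver_ideal_all_imp_zero: "(\<And>n. x \<in> ver_ideal n) \<Longrightarrow> x = 0"
  by (rule witt_vec_eqI) (auto simp: ver_ideal_def)

text \<open>Component \<open>i\<close> of the partial sums is constant from \<open>Suc i\<close>
  terms on; the limit collects these stable values.\<close>

lemma ver_adic_complete:
  assumes "\<And>i. u i \<in> ver_ideal i"
  obtains s where "\<And>n. s - (\<Sum>i<n. u i) \<in> ver_ideal n"
proof
  define S where "S n = (\<Sum>i<n. u i)" for n
  have step: "coords (S m) i = coords (S n) i" if "n \<le> m" "i < n" for m n i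
  proof -
    have "S m - S n = (\<Sum>i\<in>{n..<m}. u i)"
      unfolding S_def lessThan_atLeast0 by (rule sum_diff_nat_ivl) (use that in auto)
    also have "\<dots> \<in> ver_ideal n"
      by (rule ver_ideal_sum) (use assms ver_ideal_mono in force)
    finally show ?thesis
      using that by (simp add: diff_in_ver_ideal_iff)
  qed
  show "Witt (\<lambda>i. coords (S (Suc i)) i) - (\<Sum>i<n. u i) \<in> ver_ideal n" for n
    unfolding S_def[symmetric] diff_in_ver_ideal_iff
    using step[of "Suc i" n i for i] by simp
qed

lemma wmap_hom:
  fixes h :: "'a::comm_ring_1 \<Rightarrow> 'b::comm_ring_1"
  assumes "unital_hom h" "CHAR('a) = CHAR('b)"
  shows "unital_hom (wmap h)"
proof -
  interpret unital_hom h
    by fact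
  have "wprime TYPE('b) = wprime TYPE('a)"
    using assms(2) by (simp add: wprime_def)
  then show ?thesis
    by unfold_locales
      (simp_all add: wmap_def one_witt_vec_def plus_witt_vec_def times_witt_vec_def hom_witt)
qed

lemma wmap_ver:
  assumes "unital_hom h"
  shows "wmap h (ver x) = ver (wmap h x)"
  using unital_hom.hom_witt_shift[OF assms] by (simp add: wmap_def ver_def)

lemma wmap_ver_pow:
  assumes "unital_hom h"
  shows "wmap h ((ver ^^ n) x) = (ver ^^ n) (wmap h x)"
  by (induction n) (simp_all add: wmap_ver assms)

lemma wmap_teich:
  assumes "unital_hom h"
  shows "wmap h (teich x) = teich (h x)"
  using unital_hom.hom_witt_teich[OF assms] by (simp add: wmap_def teich_def)

lemma wmap_ver_ideal: "h 0 = 0 \<Longrightarrow> x \<in> ver_ideal n \<Longrightarrow> wmap h x \<in> ver_ideal n"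
  by (simp add: wmap_def ver_ideal_def)

lemma unital_hom_funpow:
  fixes f :: "'a::comm_ring_1 \<Rightarrow> 'a"
  assumes "unital_hom f"
  shows "unital_hom (f ^^ n)"
proof (induction n)
  case 0
  show ?case
    by (rule unital_hom.intro) simp_all
next
  case (Suc n)
  interpret f: unital_hom f
    by fact
  interpret fn: unital_hom "f ^^ n"
    by fact
  show ?case
    by unfold_locales (simp_all add: f.hom_add fn.hom_add f.hom_mult fn.hom_mult)
qed

lemma unital_hom_power_CHAR:
  assumes "prime CHAR('a::comm_ring_1)"
  shows "unital_hom (\<lambda>x :: 'a. x ^ CHAR('a))"
proof
  fix x y :: 'a
  have "(0 :: 'a) dvd (x + y) ^ CHAR('a) - x ^ CHAR('a) - y ^ CHAR('a)"
    using prime_dvd_freshman[OF assms, of x y] by simp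
  then show "(x + y) ^ CHAR('a) = x ^ CHAR('a) + y ^ CHAR('a)"
    by (simp add: algebra_simps)
qed (simp_all add: power_mult_distrib)

lemma frob_eq_wmap: "frob x = wmap (\<lambda>a. a ^ CHAR('a)) (x :: 'a::comm_ring_1 witt_vec)"
  by (simp add: frob_def wmap_def)

context
  assumes prime_CHAR: "prime CHAR('a::comm_ring_1)"
begin

interpretation power: unital_hom "\<lambda>a :: 'a. a ^ CHAR('a)"
  by (rule unital_hom_power_CHAR) (rule prime_CHAR)

lemma unital_hom_frob: "unital_hom (frob :: 'a witt_vec \<Rightarrow> _)"
  using wmap_hom[OF power.unital_hom_axioms] by (simp add: frob_eq_wmap[abs_def])

lemma frob_ver: "frob (ver x) = ver (frob (x :: 'a witt_vec))"
  unfolding frob_eq_wmap by (rule wmap_ver) (rule power.unital_hom_axioms)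

lemma frob_teich: "frob (teich a) = teich (a ^ CHAR('a) :: 'a)"
  unfolding frob_eq_wmap by (rule wmap_teich) (rule power.unital_hom_axioms)

lemma frob_teich_power: "frob (teich a ^ m) = teich (a :: 'a) ^ (CHAR('a) * m)"
  by (simp add: frob_teich mult.commute flip: teich_power power_mult)

lemma frob_pow_teich_power: "(frob ^^ n) (teich a ^ m) = teich (a :: 'a) ^ (CHAR('a) ^ n * m)"
  by (induction n) (simp_all add: frob_teich_power mult.assoc)

lemma mult_ver: "(x :: 'a witt_vec) * ver y = ver (frob x * y)"
proof -
  have "wprime TYPE('a) = CHAR('a)"
    using prime_CHAR by (simp add: wprime_def)
  then show ?thesis
    using witt_mult_shift[OF prime_CHAR, of "coords x" "coords y"]
    by (simp add: times_witt_vec_def ver_def frob_def)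
qed

lemma of_nat_CHAR_witt: "of_nat CHAR('a) = ver (1 :: 'a witt_vec)"
proof -
  have p: "wprime TYPE('a) = CHAR('a)"
    using prime_CHAR by (simp add: wprime_def)
  have "of_nat n = Witt (witt_nat CHAR('a) n :: nat \<Rightarrow> 'a)" for n
    by (induction n) (simp_all add: zero_witt_vec_def one_witt_vec_def plus_witt_vec_def p prime_CHAR)
  then show ?thesis
    by (simp add: witt_nat_prime[OF prime_CHAR] ver_def one_witt_vec_def)
qed

lemma of_nat_CHAR_mult: "of_nat CHAR('a) * (x :: 'a witt_vec) = ver (frob x)"
  using mult_ver[of x 1] by (simp add: of_nat_CHAR_witt mult.commute)

lemma frob_pow_ver_pow: "(frob ^^ m) ((ver ^^ n) x) = (ver ^^ n) ((frob ^^ m) (x :: 'a witt_vec))"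
proof -
  have "frob ((ver ^^ n) x) = (ver ^^ n) (frob x)" for x :: "'a witt_vec"
    by (induction n) (simp_all add: frob_ver)
  then show ?thesis
    by (induction m) simp_all
qed

lemma of_nat_CHAR_power_mult:
  "of_nat CHAR('a) ^ n * (x :: 'a witt_vec) = (ver ^^ n) ((frob ^^ n) x)"
proof (induction n)
  case (Suc n)
  have "of_nat CHAR('a) ^ Suc n * x = of_nat CHAR('a) * (of_nat CHAR('a) ^ n * x)"
    by (simp only: power_Suc mult.assoc)
  also have "\<dots> = ver (frob ((ver ^^ n) ((frob ^^ n) x)))"
    by (simp only: Suc of_nat_CHAR_mult)
  finally show ?case
    using frob_pow_ver_pow[of 1 n] by simp
qed simp

lemma mult_ver_pow: "(x :: 'a witt_vec) * (ver ^^ n) y = (ver ^^ n) ((frob ^^ n) x * y)"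
  by (induction n arbitrary: x) (simp_all add: mult_ver funpow_swap1[of frob])

lemma ver_pow_mult_ver_pow:
  "(ver ^^ m) x * (ver ^^ n) y = (ver ^^ (m + n)) ((frob ^^ n) x * (frob ^^ m) (y :: 'a witt_vec))"
proof -
  have "(ver ^^ m) x * (ver ^^ n) y = (ver ^^ n) ((ver ^^ m) ((frob ^^ n) x) * y)"
    by (simp add: mult_ver_pow frob_pow_ver_pow)
  also have "\<dots> = (ver ^^ n) ((ver ^^ m) ((frob ^^ m) y * (frob ^^ n) x))"
    by (simp add: mult_ver_pow mult.commute[of _ y])
  finally show ?thesis
    by (simp add: funpow_add add.commute[of m] mult.commute)
qed

lemma ver_ideal_mult:
  "x \<in> ver_ideal m \<Longrightarrow> y \<in> ver_ideal n \<Longrightarrow> x * (y :: 'a witt_vec) \<in> ver_ideal (m + n)"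
  by (auto simp: ver_ideal_iff[of x] ver_ideal_iff[of y] ver_pow_mult_ver_pow)

lemma ver_ideal_mult_right: "x \<in> ver_ideal n \<Longrightarrow> x * (y :: 'a witt_vec) \<in> ver_ideal n"
  using ver_ideal_mult[of x n y 0] by (simp add: ver_ideal_def)

lemma ver_ideal_mult_left: "x \<in> ver_ideal n \<Longrightarrow> y * (x :: 'a witt_vec) \<in> ver_ideal n"
  using ver_ideal_mult_right[of x n y] by (simp add: mult.commute)

lemma of_nat_CHAR_power_in_ver_ideal: "of_nat CHAR('a) ^ n \<in> (ver_ideal n :: 'a witt_vec set)"
  using of_nat_CHAR_power_mult[of n 1] ver_pow_in_ver_ideal[of n] by simp

lemma frob_in_ver_ideal: "x \<in> ver_ideal n \<Longrightarrow> frob (x :: 'a witt_vec) \<in> ver_ideal n"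
  by (simp add: frob_def ver_ideal_def)

end

text \<open>Injectivity permits checking an identity after a power of \<open>\<sigma>\<close>, where
  the fictitious \<open>p\<close>-power roots of \<open>S\<close> have become honest powers.\<close>

lemma inj_frob:
  assumes "prime CHAR('a::idom)"
  shows "inj (frob :: 'a witt_vec \<Rightarrow> _)"
proof (rule injI)
  fix x y :: "'a witt_vec"
  interpret unital_hom "frob :: 'a witt_vec \<Rightarrow> _"
    by (rule unital_hom_frob) fact
  assume "frob x = frob y"
  then have "frob (x - y) = 0"
    by (simp add: hom_diff)
  then have "coords (x - y) i ^ CHAR('a) = 0" for i
    by (simp add: frob_def zero_witt_vec_def Witt_inject fun_eq_iff)
  then have "x - y = 0"
    by (intro witt_vec_eqI) simp
  then show "x = y"
    by simp
qed

inductive_set zspan :: "'a::ab_group_add set \<Rightarrow> 'a set" for B where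
  zspan_zero: "0 \<in> zspan B"
| zspan_gen: "b \<in> B \<Longrightarrow> b \<in> zspan B"
| zspan_diff: "x \<in> zspan B \<Longrightarrow> y \<in> zspan B \<Longrightarrow> x - y \<in> zspan B"

lemma zspan_minus: "x \<in> zspan B \<Longrightarrow> - x \<in> zspan B"
  using zspan_diff[OF zspan_zero, of x B] by simp

lemma zspan_add: "x \<in> zspan B \<Longrightarrow> y \<in> zspan B \<Longrightarrow> x + y \<in> zspan B"
  using zspan_diff[OF _ zspan_minus, of x B y] by simp

lemma zspan_sum: "(\<And>i. i \<in> A \<Longrightarrow> g i \<in> zspan B) \<Longrightarrow> sum g A \<in> zspan B"
  by (induction A rule: infinite_finite_induct) (auto intro: zspan_add zspan_zero)

lemma zspan_mono: "A \<subseteq> B \<Longrightarrow> zspan A \<subseteq> zspan B"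
proof
  fix x
  assume "A \<subseteq> B" "x \<in> zspan A"
  from this(2) show "x \<in> zspan B"
    by induction (use \<open>A \<subseteq> B\<close> in \<open>auto intro: zspan.intros\<close>)
qed

section \<open>Solving the slope equation over \<open>W(k((t)))\<close>\<close>

definition level_exps :: "nat \<Rightarrow> nat \<Rightarrow> nat set" where
  "level_exps p L = {m * p ^ c |m c. m \<le> p ^ L \<and> c \<le> L}"

text \<open>After the smaller power of \<open>p\<close> is factored out, the new numerator is a sum
  of two numbers at most \<open>p ^ l\<close>, hence at most \<open>p ^ Suc l\<close> because
  \<open>2 \<le> p\<close>. One spare level pays for an addition of exponents.\<close>

lemma level_exps_add:
  assumes "p > 1" "f \<le> L" "f' \<le> L" "L = Suc l" "m * p ^ (f - f') \<le> p ^ l" "m' * p ^ (f' - f) \<le> p ^ l"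
  shows "m * p ^ f + m' * p ^ f' \<in> level_exps p L"
proof -
  define g where "g = min f f'"
  have "f = (f - f') + g" "f' = (f' - f) + g"
    by (auto simp: g_def)
  then have "m * p ^ f + m' * p ^ f' = (m * p ^ (f - f') + m' * p ^ (f' - f)) * p ^ g"
    by (metis (no_types, lifting) add_mult_distrib mult.assoc power_add)
  moreover have "m * p ^ (f - f') + m' * p ^ (f' - f) \<le> p ^ L"
  proof -
    have "2 * p ^ l \<le> p * p ^ l"
      using assms(1) by (intro mult_right_mono) auto
    then show ?thesis
      unfolding assms(4) power_Suc using assms(5,6) by linarith
  qed
  moreover have "g \<le> L"
    using assms(2) by (simp add: g_def)
  ultimately show ?thesis
    unfolding level_exps_def by blast
qed

text \<open>\<open>s\<close> will be \<open>t^-1\<close> in \<open>k((t))\<close>. The argument up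
  to \<open>series_solution\<close> is formal in \<open>s\<close>; poles are compared with powers of
  \<open>t\<close> only in \<open>slope_equation_solution\<close>.\<close>

locale frobenius_series =
  fixes s :: "'a::idom" and p :: nat
  assumes CHAR: "CHAR('a) = p" and prime_p: "prime p"
begin

lemma prime_CHAR: "prime CHAR('a)"
  by (simp add: CHAR prime_p)

lemmas of_nat_p_in_ver_ideal = of_nat_CHAR_power_in_ver_ideal[OF prime_CHAR, unfolded CHAR]

interpretation unital_hom "frob :: 'a witt_vec \<Rightarrow> _"
  by (rule unital_hom_frob) (rule prime_CHAR)

interpretation frob_pow: unital_hom "frob ^^ n :: 'a witt_vec \<Rightarrow> _" for n
  by (rule unital_hom_funpow) (rule unital_hom_axioms)

abbreviation (input) "S \<equiv> teich s"

text \<open>The elements of \<open>level L\<close> and \<open>rooted L\<close> stand for their images under \<open>\<sigma>\<^sup>-\<^sup>L\<close>, so \<open>S ^ (m * p ^ c)\<close>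
  stands for the power of \<open>S\<close> with exponent \<open>m / p\<^sup>L\<^sup>-\<^sup>c\<close>. In \<open>rooted L\<close> these exponents are at most 1.\<close>

definition level :: "nat \<Rightarrow> 'a witt_vec set" where
  "level L = zspan ((\<lambda>n. S ^ n) ` level_exps p L)"

definition rooted :: "nat \<Rightarrow> 'a witt_vec set" where
  "rooted L = zspan ((\<lambda>n. S ^ n) ` {..p ^ L})"

lemma rooted_subset_level: "rooted L \<subseteq> level L"
  unfolding rooted_def level_def
proof (rule zspan_mono, rule image_mono, rule subsetI)
  fix m
  assume "m \<in> {..p ^ L}"
  then show "m \<in> level_exps p L"
    unfolding level_exps_def by (intro CollectI exI[of _ m] exI[of _ 0]) simp
qed

lemma one_in_level: "1 \<in> level L"
proof -
  have "S ^ 0 \<in> level L"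
    unfolding level_def level_exps_def by (intro zspan_gen imageI) auto
  then show ?thesis
    by simp
qed

text \<open>As \<open>S ^ (m * p ^ c)\<close> is \<open>\<sigma>^c\<close> applied to
  \<open>S ^ m\<close>, their difference telescopes to \<open>k - \<sigma> k\<close> with
  \<open>k\<close> minus the sum of \<open>S ^ (m * p ^ j)\<close> over \<open>j < c\<close>, and
  these exponents stay in the same level.\<close>

lemma extract_roots:
  assumes "y \<in> level L"
  shows "\<exists>r k. r \<in> rooted L \<and> k \<in> level L \<and> k - frob k = y - r"
  using assms unfolding level_def
proof induction
  case zspan_zero
  show ?case
    by (rule exI[of _ 0], rule exI[of _ 0]) (auto simp: rooted_def intro: zspan.intros)
next
  case (zspan_gen b)
  then obtain m c where b: "b = S ^ (m * p ^ c)" "m \<le> p ^ L" "c \<le> L"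
    by (auto simp: level_exps_def)
  show ?case
    unfolding b(1) using b(3)
  proof (induction c)
    case 0
    have "S ^ m \<in> rooted L"
      unfolding rooted_def by (intro zspan.zspan_gen imageI) (use b in simp)
    then show ?case
      by - (rule exI[of _ "S ^ m"], rule exI[of _ 0], auto intro: zspan.intros)
  next
    case (Suc c)
    let ?P = "zspan ((\<lambda>n. S ^ n) ` level_exps p L)"
    from Suc obtain r k where rk: "r \<in> rooted L" "k \<in> ?P" "k - frob k = S ^ (m * p ^ c) - r"
      by auto
    have "S ^ (m * p ^ c) \<in> ?P"
      unfolding level_exps_def
      by (intro zspan.zspan_gen imageI CollectI exI[of _ m] exI[of _ c]) (use b(2) Suc.prems in simp)
    with rk(2) have "k - S ^ (m * p ^ c) \<in> ?P"
      by (rule zspan.zspan_diff)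
    moreover have "frob (S ^ (m * p ^ c)) = S ^ (m * p ^ Suc c)"
      by (simp add: frob_teich_power[OF prime_CHAR, unfolded CHAR] mult_ac)
    then have "(k - S ^ (m * p ^ c)) - frob (k - S ^ (m * p ^ c)) = S ^ (m * p ^ Suc c) - r"
      using rk(3) by (simp add: hom_diff algebra_simps)
    ultimately show ?case
      using rk(1) by blast
  qed
next
  case (zspan_diff x y)
  then obtain r k r' k' where "r \<in> rooted L" "k \<in> zspan ((\<lambda>n. S ^ n) ` level_exps p L)" "k - frob k = x - r"
    "r' \<in> rooted L" "k' \<in> zspan ((\<lambda>n. S ^ n) ` level_exps p L)" "k' - frob k' = y - r'"
    by blast
  moreover have "(k - k') - frob (k - k') = (k - frob k) - (k' - frob k')"
    by (simp add: hom_diff)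
  ultimately show ?case
    by - (rule exI[of _ "r - r'"], rule exI[of _ "k - k'"],
      auto simp: rooted_def intro: zspan.zspan_diff)
qed

text \<open>With \<open>x\<close> standing for \<open>\<sigma>^-L x\<close> and \<open>y\<close> for
  \<open>\<sigma>^-L' y\<close>, this represents at the new level the product of the first with
  \<open>\<sigma>\<close> of the second. Of the two extra levels, one absorbs the factor
  \<open>p\<close> that \<open>\<sigma>\<close> puts on the exponents of \<open>y\<close>, the other
  the addition of exponents.\<close>

lemma level_product:
  assumes "x \<in> level L" "y \<in> level L'"
  shows "(frob ^^ (L' + 2)) x * (frob ^^ (L + 3)) y \<in> level (L + L' + 2)"
proof -
  note p = prime_gt_1_nat[OF prime_p]
  define F G where "F = (frob ^^ (L' + 2) :: 'a witt_vec \<Rightarrow> _)" and "G = (frob ^^ (L + 3) :: 'a witt_vec \<Rightarrow> _)"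
  define Z where "Z = level (L + L' + 2)"
  have Z: "0 \<in> Z" "\<And>u v. u \<in> Z \<Longrightarrow> v \<in> Z \<Longrightarrow> u - v \<in> Z"
    unfolding Z_def level_def by (rule zspan.intros; assumption?)+
  have hom: "F (u - v) = F u - F v" "G (u - v) = G u - G v" "F 0 = 0" "G 0 = 0" for u v
    unfolding F_def G_def by (rule frob_pow.hom_diff frob_pow.hom_zero)+
  have gen: "F (S ^ n) * G (S ^ n') \<in> Z"
    if n: "n \<in> level_exps p L" "n' \<in> level_exps p L'" for n n'
  proof -
    from n obtain m c m' c' where
      n': "n = m * p ^ c" "m \<le> p ^ L" "c \<le> L" "n' = m' * p ^ c'" "m' \<le> p ^ L'" "c' \<le> L'"
      unfolding level_exps_def by blast
    define f f' where "f = c + L' + 2" and "f' = c' + L + 2"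
    have "p ^ (f - f') \<le> p ^ (L' + 1)" "p ^ (f' - f) \<le> p ^ L"
      by (rule power_increasing; use n' p in \<open>simp add: f_def f'_def\<close>)+
    then have "m * p ^ (f - f') \<le> p ^ L * p ^ (L' + 1)" "(m' * p) * p ^ (f' - f) \<le> (p ^ L' * p) * p ^ L"
      by (intro mult_mono; use n' in simp)+
    then have "m * p ^ f + (m' * p) * p ^ f' \<in> level_exps p (L + L' + 2)"
      by (intro level_exps_add[where l = "L + L' + 1"])
        (use n' p in \<open>auto simp: f_def f'_def power_add mult_ac\<close>)
    moreover have "F (S ^ n) * G (S ^ n') = S ^ (m * p ^ f + (m' * p) * p ^ f')"
      by (simp only: F_def G_def frob_pow_teich_power[OF prime_CHAR, unfolded CHAR] flip: power_add)
        (simp add: n' f_def f'_def power_add mult_ac eval_nat_numeral)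
    ultimately show ?thesis
      unfolding Z_def level_def by (simp add: zspan_gen)
  qed
  have "F (S ^ n) * G y \<in> Z" if "n \<in> level_exps p L" for n
    using assms(2) unfolding level_def
    by induction
      (use gen[OF that] in \<open>auto simp: hom right_diff_distrib Z\<close>)
  with assms(1)[unfolded level_def] have "F x * G y \<in> Z"
    by induction (auto simp: hom left_diff_distrib Z)
  then show ?thesis
    by (simp only: F_def G_def Z_def)
qed

text \<open>The term \<open>S ^ (p\<^sup>2 - 1) * \<sigma>^2 y\<close>, represented at level
  \<open>L\<close>. Two of the three extra levels absorb the factors \<open>p\<^sup>2 - 1\<close>
  and \<open>p\<^sup>2\<close> in the exponents, the third their addition.\<close>

lemma level_product_q:
  assumes "y \<in> level L'" "L' + 3 \<le> L"
  shows "S ^ ((p\<^sup>2 - 1) * p ^ L) * (frob ^^ (2 + L - L')) y \<in> level L"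
  using assms(1)[unfolded level_def]
proof induction
  case (zspan_gen b)
  note p = prime_gt_1_nat[OF prime_p]
  from zspan_gen obtain m c where b: "b = S ^ (m * p ^ c)" "m \<le> p ^ L'" "c \<le> L'"
    by (auto simp: level_exps_def)
  define f where "f = c + (L - L')"
  have "(p\<^sup>2 - 1) * p ^ (L - f) \<le> p ^ (2 + L')"
    unfolding power_add
    by (rule mult_mono) (use b assms(2) p in \<open>auto simp: f_def intro!: power_increasing\<close>)
  moreover have "(m * p\<^sup>2) * p ^ (f - L) \<le> p ^ (2 + L')"
    using b assms(2) by (simp add: f_def power_add eval_nat_numeral)
  moreover have "p ^ (2 + L') \<le> p ^ (L - 1)"
    by (rule power_increasing) (use assms(2) p in auto)
  ultimately have "(p\<^sup>2 - 1) * p ^ (L - f) \<le> p ^ (L - 1)" "(m * p\<^sup>2) * p ^ (f - L) \<le> p ^ (L - 1)"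
    by (blast intro: order_trans)+
  then have "(p\<^sup>2 - 1) * p ^ L + (m * p\<^sup>2) * p ^ f \<in> level_exps p L"
    by (intro level_exps_add[where l = "L - 1"]) (use b p assms(2) in \<open>auto simp: f_def\<close>)
  moreover have "S ^ ((p\<^sup>2 - 1) * p ^ L) * (frob ^^ (2 + L - L')) b =
      S ^ ((p\<^sup>2 - 1) * p ^ L + (m * p\<^sup>2) * p ^ f)"
  proof -
    have "2 + L - L' = 2 + (L - L')"
      using assms(2) by simp
    then have "p ^ (2 + L - L') * (m * p ^ c) = (m * p\<^sup>2) * p ^ f"
      by (simp only: f_def power_add mult_ac)
    then show ?thesis
      by (simp only: b(1) frob_pow_teich_power[OF prime_CHAR, unfolded CHAR] power_add)
  qed
  ultimately show ?case
    unfolding level_def by (simp add: zspan.zspan_gen)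
qed (auto simp: frob_pow.hom_diff right_diff_distrib level_def intro: zspan.intros)

text \<open>The offset 2 makes \<open>lev k + lev (n - k) + 2 = lev n\<close> for
  \<open>0 < k < n\<close>, as \<open>level_product\<close> demands. The slope 5 then yields
  \<open>lev 1 = 3\<close>, just enough for \<open>level_product_q\<close> to start from
  \<open>lev 0 = 0\<close>, a truncated difference.\<close>

abbreviation (input) "lev i \<equiv> 5 * i - (2 :: nat)"

text \<open>The equations of the single orders in \<open>p ^ 5\<close>, with
  \<open>\<sigma>^(lev n)\<close> applied to the one of order \<open>n\<close>: \<open>z n\<close>
  and \<open>a n\<close> stand for their images under \<open>\<sigma>^-(lev n)\<close>, whence the
  differences of levels in the exponents of \<open>frob\<close>.\<close>

lemma recursion_solution:
  obtains z a :: "nat \<Rightarrow> 'a witt_vec" where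
    "z 0 = 1" "a 0 = 0" "\<And>n. a n \<in> rooted (lev n)"
    "\<And>n. n > 0 \<Longrightarrow> z n - frob (z n) = a n +
      (\<Sum>k\<in>{1..<n}. (frob ^^ (lev n - lev k)) (a k) * (frob ^^ (1 + lev n - lev (n - k))) (z (n - k))) +
      S ^ ((p\<^sup>2 - 1) * p ^ lev n) * (frob ^^ (2 + lev n - lev (n - 1))) (z (n - 1))"
proof -
  \<comment> \<open>The part of order \<open>n\<close> known from lower orders. The unknown
    \<open>a n\<close> is the product with \<open>z 0 = 1\<close> and stays outside; the index
    \<open>k = 0\<close> is absent because \<open>a 0 = 0\<close>.\<close>
  define Y where "Y n h = (\<Sum>k\<in>{1..<n}. (frob ^^ (lev n - lev k)) (snd (h k)) *
      (frob ^^ (1 + lev n - lev (n - k))) (fst (h (n - k)))) +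
      S ^ ((p\<^sup>2 - 1) * p ^ lev n) * (frob ^^ (2 + lev n - lev (n - 1))) (fst (h (n - 1)))"
    for n :: nat and h :: "nat \<Rightarrow> 'a witt_vec \<times> 'a witt_vec"
  \<comment> \<open>That \<open>z n\<close> lies in its level is an invariant of the recursion:
    higher orders use it to bound their own exponents.\<close>
  define R where "R h n za \<longleftrightarrow> (if n = 0 then za = (1, 0) else fst za \<in> level (lev n) \<and>
      snd za \<in> rooted (lev n) \<and> fst za - frob (fst za) = snd za + Y n h)" for h n za
  have "\<exists>h. \<forall>n. R h n (h n)"
  proof (rule dependent_wellorder_choice)
    fix h :: "nat \<Rightarrow> 'a witt_vec \<times> 'a witt_vec" and n
    assume h: "\<And>y. y < n \<Longrightarrow> R h y (h y)"
    show "\<exists>za. R h n za"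
    proof (cases "n = 0")
      case False
      have lev_h: "fst (h i) \<in> level (lev i)" if "i < n" for i
        using h[OF that] one_in_level by (cases "i = 0") (auto simp: R_def)
      have "Y n h \<in> level (lev n)"
        unfolding Y_def level_def
      proof (intro zspan_add zspan_sum; (fold level_def)?)
        fix k
        assume k: "k \<in> {1..<n}"
        have e: "lev n - lev k = lev (n - k) + 2" "1 + lev n - lev (n - k) = lev k + 3"
          "lev n = lev k + lev (n - k) + 2"
          using k by auto
        have "snd (h k) \<in> level (lev k)"
          using h[of k] k rooted_subset_level by (auto simp: R_def)
        moreover have "n - k < n"
          using k by auto
        ultimately have "(frob ^^ (lev (n - k) + 2)) (snd (h k)) *
            (frob ^^ (lev k + 3)) (fst (h (n - k))) \<in> level (lev k + lev (n - k) + 2)"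
          by (intro level_product lev_h)
        then
        show "(frob ^^ (lev n - lev k)) (snd (h k)) *
            (frob ^^ (1 + lev n - lev (n - k))) (fst (h (n - k))) \<in> level (lev n)"
          by (simp only: e(1,2) e(3)[symmetric])
      next
        show "S ^ ((p\<^sup>2 - 1) * p ^ lev n) * (frob ^^ (2 + lev n - lev (n - 1))) (fst (h (n - 1))) \<in> level (lev n)"
          by (rule level_product_q[OF lev_h]) (use False in auto)
      qed
      \<comment> \<open>Choosing \<open>a n = - r\<close> cancels the part with small poles, and
        \<open>z n = k\<close> solves what remains.\<close>
      then obtain r k where "r \<in> rooted (lev n)" "k \<in> level (lev n)" "k - frob k = Y n h - r"
        using extract_roots by blast
      then show ?thesis
        using False by (intro exI[of _ "(k, - r)"]) (auto simp: R_def rooted_def zspan_minus)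
    qed (simp add: R_def)
  next
    fix za and h h' :: "nat \<Rightarrow> 'a witt_vec \<times> 'a witt_vec" and n
    assume eq: "\<And>y. y < n \<Longrightarrow> h y = h' y"
    show "R h n za = R h' n za"
    proof (cases "n = 0")
      case False
      then have "Y n h = Y n h'"
        unfolding Y_def by (intro arg_cong2[of _ _ _ _ "(+)"] sum.cong) (auto simp: eq)
      then show ?thesis
        by (simp add: R_def)
    qed (simp add: R_def)
  qed
  then obtain h where h: "\<And>n. R h n (h n)"
    by blast
  show ?thesis
  proof (rule that[of "\<lambda>n. fst (h n)" "\<lambda>n. snd (h n)"])
    show "fst (h 0) = 1" "snd (h 0) = 0"
      using h[of 0] by (simp_all add: R_def)
    show "snd (h n) \<in> rooted (lev n)" for n
      using h[of n] by (cases "n = 0") (auto simp: R_def rooted_def intro: zspan_zero)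
    show "fst (h n) - frob (fst (h n)) = snd (h n) +
      (\<Sum>k\<in>{1..<n}. (frob ^^ (lev n - lev k)) (snd (h k)) * (frob ^^ (1 + lev n - lev (n - k))) (fst (h (n - k)))) +
      S ^ ((p\<^sup>2 - 1) * p ^ lev n) * (frob ^^ (2 + lev n - lev (n - 1))) (fst (h (n - 1)))"
      if "n > 0" for n
      using h[of n] that by (simp add: R_def Y_def add.assoc)
  qed
qed

text \<open>This is \<open>p\<^sup>5\<^sup>i \<sigma>\<^sup>-\<^sup>L x\<close> with \<open>L = 5 i - 2\<close>.\<close>

definition descend :: "nat \<Rightarrow> 'a witt_vec \<Rightarrow> 'a witt_vec" where
  "descend i x = of_nat p ^ (5 * i - lev i) * (ver ^^ lev i) x"

text \<open>Since \<open>\<sigma>^L V^L = p ^ L\<close>, a high enough power of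
  \<open>\<sigma>\<close> clears the formal roots. In this way terms of different levels are
  compared.\<close>

lemma frob_pow_descend:
  assumes "lev i \<le> n"
  shows "(frob ^^ n) (descend i x) = of_nat p ^ (5 * i) * (frob ^^ (n - lev i)) x"
proof -
  have "(frob ^^ n) ((ver ^^ lev i) x) = (frob ^^ lev i) ((ver ^^ lev i) ((frob ^^ (n - lev i)) x))"
    using funpow_add[of "lev i" "n - lev i" "frob :: 'a witt_vec \<Rightarrow> _"] assms
    by (simp add: frob_pow_ver_pow[OF prime_CHAR])
  also have "\<dots> = of_nat p ^ lev i * (frob ^^ (n - lev i)) x"
    by (simp only: frob_pow_ver_pow[OF prime_CHAR] of_nat_CHAR_power_mult[OF prime_CHAR, unfolded CHAR])
  finally have "(frob ^^ n) (descend i x) = of_nat p ^ (5 * i - lev i) * (of_nat p ^ lev i * (frob ^^ (n - lev i)) x)"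
    by (simp add: descend_def frob_pow.hom_mult frob_pow.hom_power frob_pow.hom_of_nat)
  then show ?thesis
    by (simp flip: power_add mult.assoc)
qed

lemma descend_in_ver_ideal: "descend i x \<in> ver_ideal (5 * i)"
proof -
  have "descend i x \<in> ver_ideal ((5 * i - lev i) + lev i)"
    unfolding descend_def
    by (intro ver_ideal_mult prime_CHAR of_nat_p_in_ver_ideal ver_pow_in_ver_ideal)
  then show ?thesis
    by simp
qed

text \<open>The orders are assembled: \<open>descend i\<close> of the recursive solutions lies in
  \<open>ver_ideal (5 * i)\<close>, so the series converge. The summands of \<open>b\<close> remain
  visible because integrality is later checked term by term.\<close>

lemma series_solution:
  obtains z b a where
    "z = (1 + b) * frob z + of_nat p ^ 5 * S ^ (p\<^sup>2 - 1) * frob (frob z)"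
    "coords z 0 = 1" "\<And>i. a i \<in> rooted (lev i)"
    "\<And>n. b - (\<Sum>i<n. descend i (a i)) \<in> ver_ideal n"
proof -
  obtain zh a :: "nat \<Rightarrow> 'a witt_vec" where za: "zh 0 = 1" "a 0 = 0" "\<And>n. a n \<in> rooted (lev n)"
    and rec: "\<And>n. n > 0 \<Longrightarrow> zh n - frob (zh n) = a n +
      (\<Sum>k\<in>{1..<n}. (frob ^^ (lev n - lev k)) (a k) * (frob ^^ (1 + lev n - lev (n - k))) (zh (n - k))) +
      S ^ ((p\<^sup>2 - 1) * p ^ lev n) * (frob ^^ (2 + lev n - lev (n - 1))) (zh (n - 1))"
    by (rule recursion_solution) blast
  define w where "w i = descend i (zh i)" for i
  define b where "b i = descend i (a i)" for i
  let ?q = "of_nat p ^ 5 * S ^ (p\<^sup>2 - 1)"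
  have w0: "w 0 = 1" and b0: "b 0 = 0"
    by (simp_all add: w_def b_def descend_def za)
  have wI: "w i \<in> ver_ideal (5 * i)" and bI: "b i \<in> ver_ideal (5 * i)" for i
    by (simp_all add: w_def b_def descend_in_ver_ideal)
  have inj: "inj (frob ^^ n :: 'a witt_vec \<Rightarrow> _)" for n
    by (intro inj_fn inj_frob prime_CHAR)
  \<comment> \<open>The coefficient identity of order \<open>n\<close>. After the injective map
    \<open>\<sigma>^L\<close> with \<open>L = lev n\<close> it becomes \<open>p ^ (5 * n)\<close>
    times the recursion for \<open>zh n\<close>.\<close>
  have w_rec: "w n = frob (w n) + (\<Sum>k\<le>n. b k * frob (w (n - k))) +
      (if n = 0 then 0 else ?q * frob (frob (w (n - 1))))" for n
  proof (cases "n = 0")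
    case True
    then show ?thesis
      by (simp add: w0 b0)
  next
    case False
    then have n_pos: "n > 0"
      by simp
    define L where "L = lev n"
    have lev_le: "lev k \<le> L" if "k \<le> n" for k
      using that by (simp add: L_def)
    have frob_w: "(frob ^^ (j + L)) (w k) = of_nat p ^ (5 * k) * (frob ^^ (j + L - lev k)) (zh k)"
      if "k \<le> n" for j k
      unfolding w_def by (rule frob_pow_descend) (use lev_le[OF that] in simp)
    have frob_b: "(frob ^^ L) (b k) = of_nat p ^ (5 * k) * (frob ^^ (L - lev k)) (a k)" if "k \<le> n" for k
      unfolding b_def by (rule frob_pow_descend[OF lev_le[OF that]])
    have comm: "(frob ^^ L) (frob x) = (frob ^^ (1 + L)) x" "(frob ^^ L) (frob (frob x)) = (frob ^^ (2 + L)) x"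
      for x :: "'a witt_vec"
      by (simp_all add: funpow_swap1 eval_nat_numeral)
    have "(frob ^^ L) (w n - frob (w n)) = of_nat p ^ (5 * n) * (zh n - frob (zh n))"
      using frob_w[of n 0] frob_w[of n 1]
      by (simp only: frob_pow.hom_diff comm) (simp add: right_diff_distrib Suc_diff_le L_def)
    also have "\<dots> = of_nat p ^ (5 * n) * a n +
       (\<Sum>k\<in>{1..<n}. of_nat p ^ (5 * n) * ((frob ^^ (L - lev k)) (a k) * (frob ^^ (1 + L - lev (n - k))) (zh (n - k)))) +
       of_nat p ^ (5 * n) * (S ^ ((p\<^sup>2 - 1) * p ^ L) * (frob ^^ (2 + L - lev (n - 1))) (zh (n - 1)))"
      unfolding L_def rec[OF n_pos] by (simp only: ring_distribs sum_distrib_left)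
    also have "of_nat p ^ (5 * n) * a n = (frob ^^ L) (b n)"
      using frob_b[of n] by (simp add: L_def)
    also have "(\<Sum>k\<in>{1..<n}. of_nat p ^ (5 * n) * ((frob ^^ (L - lev k)) (a k) * (frob ^^ (1 + L - lev (n - k))) (zh (n - k)))) =
       (\<Sum>k\<in>{1..<n}. (frob ^^ L) (b k * frob (w (n - k))))"
    proof (rule sum.cong)
      fix k
      assume k: "k \<in> {1..<n}"
      then have "5 * n = 5 * k + 5 * (n - k)"
        unfolding add_mult_distrib2[symmetric] by simp
      then have "of_nat p ^ (5 * n) = (of_nat p ^ (5 * k) * of_nat p ^ (5 * (n - k)) :: 'a witt_vec)"
        by (subst power_add[symmetric]) simp
      then show "of_nat p ^ (5 * n) * ((frob ^^ (L - lev k)) (a k) * (frob ^^ (1 + L - lev (n - k))) (zh (n - k))) =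
          (frob ^^ L) (b k * frob (w (n - k)))"
        using k by (simp only: frob_pow.hom_mult comm frob_b frob_w) (simp add: mult_ac frob_b frob_w[of _ 1, simplified])
    qed simp
    also have "of_nat p ^ (5 * n) * (S ^ ((p\<^sup>2 - 1) * p ^ L) * (frob ^^ (2 + L - lev (n - 1))) (zh (n - 1))) =
        (frob ^^ L) (?q * frob (frob (w (n - 1))))"
    proof -
      have "of_nat p ^ (5 * n) = (of_nat p ^ 5 * of_nat p ^ (5 * (n - 1)) :: 'a witt_vec)"
        using False by (simp flip: power_add) (simp add: right_diff_distrib')
      moreover have "(frob ^^ L) ?q = of_nat p ^ 5 * S ^ ((p\<^sup>2 - 1) * p ^ L)"
        by (simp only: frob_pow.hom_mult frob_pow.hom_power[of _ "of_nat p"] frob_pow.hom_of_nat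
          frob_pow_teich_power[OF prime_CHAR, unfolded CHAR] mult.commute[of "p ^ L"])
      ultimately show ?thesis
        using frob_w[of "n - 1" 2, OF diff_le_self]
        by (simp only: frob_pow.hom_mult[of _ ?q] comm(2)) (simp only: mult_ac)
    qed
    also have "(frob ^^ L) (b n) + (\<Sum>k\<in>{1..<n}. (frob ^^ L) (b k * frob (w (n - k)))) + (frob ^^ L) (?q * frob (frob (w (n - 1)))) =
        (frob ^^ L) (b n + (\<Sum>k\<in>{1..<n}. b k * frob (w (n - k))) + ?q * frob (frob (w (n - 1))))"
      by (simp only: frob_pow.hom_add frob_pow.hom_sum)
    finally have "w n - frob (w n) = b n + (\<Sum>k\<in>{1..<n}. b k * frob (w (n - k))) + ?q * frob (frob (w (n - 1)))"
      by (rule injD[OF inj])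
    moreover have "{..n} = insert 0 (insert n {1..<n})"
      using False by auto
    ultimately show ?thesis
      using False by (simp add: w0 b0 algebra_simps)
  qed
  have wIi: "w i \<in> ver_ideal i" and bIi: "b i \<in> ver_ideal i" for i
    using wI[of i] bI[of i] ver_ideal_mono[of i "5 * i"] by auto
  obtain z where z: "\<And>n. z - (\<Sum>i<n. w i) \<in> ver_ideal n"
    using ver_adic_complete[of w] wIi by blast
  obtain c where c: "\<And>n. c - (\<Sum>i<n. b i) \<in> ver_ideal n"
    using ver_adic_complete[of b] bIi by blast
  \<comment> \<open>It suffices to verify the equation modulo every \<open>ver_ideal n\<close>,
    where \<open>z\<close> and \<open>c\<close> may be replaced by their partial sums. Adding the
    identities of order below \<open>n\<close> yields exactly the products
    \<open>b k * \<sigma> (w l)\<close> with \<open>k + l < n\<close>.\<close>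
  have "z - ((1 + c) * frob z + ?q * frob (frob z)) \<in> ver_ideal n" for n
  proof -
    define Z B where "Z = (\<Sum>i<n. w i)" and "B = (\<Sum>i<n. b i)"
    have zZ: "z - Z \<in> ver_ideal n" and cB: "c - B \<in> ver_ideal n"
      unfolding Z_def B_def by (rule z, rule c)
    have "Z = (\<Sum>i<n. frob (w i)) + (\<Sum>i<n. \<Sum>k\<le>i. b k * frob (w (i - k))) +
        (\<Sum>i<n. if i = 0 then 0 else ?q * frob (frob (w (i - 1))))"
      unfolding Z_def sum.distrib[symmetric] by (rule sum.cong[OF refl w_rec])
    also have "(\<Sum>i<n. frob (w i)) = frob Z"
      by (simp add: Z_def hom_sum)
    also have "(\<Sum>i<n. \<Sum>k\<le>i. b k * frob (w (i - k))) = (\<Sum>(k, l)\<in>{(k, l). k + l < n}. b k * frob (w l))"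
      by (rule sum.triangle_reindex[symmetric])
    finally have Z_eq: "Z = frob Z + (\<Sum>(k, l)\<in>{(k, l). k + l < n}. b k * frob (w l)) +
        (\<Sum>i<n. if i = 0 then 0 else ?q * frob (frob (w (i - 1))))" .
    \<comment> \<open>The excess products have \<open>k + l \<ge> n\<close> and lie in
      \<open>ver_ideal (5 * k + 5 * l)\<close>.\<close>
    have "B * frob Z - (\<Sum>(k, l)\<in>{(k, l). k + l < n}. b k * frob (w l)) =
        (\<Sum>(k, l)\<in>{..<n} \<times> {..<n} - {(k, l). k + l < n}. b k * frob (w l))"
    proof -
      have "B * frob Z = (\<Sum>(k, l)\<in>{..<n} \<times> {..<n}. b k * frob (w l))"
        by (simp add: B_def Z_def hom_sum sum_product sum.cartesian_product)
      then show ?thesis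
        by (subst sum_diff) auto
    qed
    also have "\<dots> \<in> ver_ideal n"
    proof (rule ver_ideal_sum)
      fix kl
      assume "kl \<in> {..<n} \<times> {..<n} - {(k, l). k + l < n}"
      then obtain k l where kl: "kl = (k, l)" "\<not> k + l < n"
        by (cases kl) auto
      have "b k * frob (w l) \<in> ver_ideal (5 * k + 5 * l)"
        by (intro ver_ideal_mult prime_CHAR bI frob_in_ver_ideal wI)
      then show "(case kl of (k, l) \<Rightarrow> b k * frob (w l)) \<in> ver_ideal n"
        using ver_ideal_mono[of n "5 * k + 5 * l"] kl by auto
    qed
    finally have cross: "B * frob Z - (\<Sum>(k, l)\<in>{(k, l). k + l < n}. b k * frob (w l)) \<in> ver_ideal n" .
    \<comment> \<open>The shift of order by one leaves a single excess term, with index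
      \<open>m = n - 1\<close>; the factor \<open>p ^ 5\<close> puts it into
      \<open>ver_ideal (5 + 5 * m)\<close>.\<close>
    have tail: "?q * frob (frob Z) - (\<Sum>i<n. if i = 0 then 0 else ?q * frob (frob (w (i - 1)))) \<in> ver_ideal n"
    proof (cases n)
      case (Suc m)
      have "(\<Sum>i<n. if i = 0 then 0 else ?q * frob (frob (w (i - 1)))) = (\<Sum>i<m. ?q * frob (frob (w i)))"
        by (simp add: Suc sum.lessThan_Suc_shift del: sum.lessThan_Suc)
      moreover have "?q * frob (frob Z) = (\<Sum>i<n. ?q * frob (frob (w i)))"
        by (simp add: Z_def hom_sum sum_distrib_left)
      moreover have "?q * frob (frob (w m)) \<in> ver_ideal (5 + 5 * m)"
        by (intro ver_ideal_mult prime_CHAR ver_ideal_mult_right of_nat_p_in_ver_ideal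
          frob_in_ver_ideal wI)
      ultimately show ?thesis
        using ver_ideal_mono[of n "5 + 5 * m"] by (auto simp: Suc)
    qed (simp add: Z_def)
    have "z - ((1 + c) * frob z + ?q * frob (frob z)) =
        (z - Z) - frob (z - Z) - (c - B) * frob z - B * frob (z - Z) - ?q * frob (frob (z - Z)) +
        (Z - frob Z - B * frob Z - ?q * frob (frob Z))"
      by (simp add: hom_diff algebra_simps)
    also have "Z - frob Z - B * frob Z - ?q * frob (frob Z) =
        - (B * frob Z - (\<Sum>(k, l)\<in>{(k, l). k + l < n}. b k * frob (w l))) -
        (?q * frob (frob Z) - (\<Sum>i<n. if i = 0 then 0 else ?q * frob (frob (w (i - 1)))))"
      using Z_eq by (simp add: algebra_simps)
    finally show ?thesis
      using cross tail zZ frob_in_ver_ideal[OF prime_CHAR zZ] ver_ideal_mult_right[OF prime_CHAR cB]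
        ver_ideal_mult_left[OF prime_CHAR frob_in_ver_ideal[OF prime_CHAR zZ]]
        ver_ideal_mult_left[OF prime_CHAR frob_in_ver_ideal[OF prime_CHAR frob_in_ver_ideal[OF prime_CHAR zZ]]]
      by (simp only: ver_ideal_add ver_ideal_diff ver_ideal_minus)
  qed
  then have "z = (1 + c) * frob z + ?q * frob (frob z)"
    using ver_ideal_all_imp_zero[of "z - ((1 + c) * frob z + ?q * frob (frob z))"] by simp
  moreover have "coords z 0 = 1"
    using z[of 1] by (simp add: w0 diff_in_ver_ideal_iff)
  ultimately show ?thesis
    using that za(3) c unfolding b_def by blast
qed

end

section \<open>Integrality: descending the coefficient of the equation to
  \<open>W(k[[t]])\<close>\<close>

lemma unital_hom_fps_to_fls: "unital_hom (fps_to_fls :: 'k::field fps \<Rightarrow> 'k fls)"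
  by unfold_locales (simp_all add: fls_times_fps_to_fls)

lemma fls_X_inv_notin_range: "(fls_X_inv :: 'k::field fls) \<notin> range fps_to_fls"
proof
  assume "(fls_X_inv :: 'k fls) \<in> range fps_to_fls"
  then obtain f :: "'k fps" where "fls_X_inv = fps_to_fls f"
    by blast
  then have "fls_nth fls_X_inv (-1) = fls_nth (fps_to_fls f) (-1)"
    by simp
  then show False
    by simp
qed

lemma slope_equation_solution:
  assumes CHAR: "CHAR('k::field) = p" and p: "prime p"
  obtains x :: "'k::field fls witt_vec" and a :: "'k fps witt_vec" where
    "x = wmap fps_to_fls a * frob x + of_nat p ^ 5 * frob (frob x)"
    "coords x 0 \<notin> range fps_to_fls"
proof -
  let ?\<iota> = "fps_to_fls :: 'k fps \<Rightarrow> 'k fls"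
  let ?S = "teich fls_X_inv :: 'k fls witt_vec" and ?T = "teich fls_X :: 'k fls witt_vec"
  interpret frobenius_series "fls_X_inv :: 'k fls" p
    by unfold_locales (simp_all add: CHAR p)
  have CHARs: "CHAR('k fps) = p" "CHAR('k fls) = p" "prime CHAR('k fps)" "prime CHAR('k fls)"
    using CHAR p by simp_all
  interpret \<iota>: unital_hom ?\<iota>
    by (rule unital_hom_fps_to_fls)
  interpret W\<iota>: unital_hom "wmap ?\<iota>"
    by (rule wmap_hom[OF \<iota>.unital_hom_axioms]) simp
  interpret frob: unital_hom "frob :: 'k fls witt_vec \<Rightarrow> _"
    by (rule unital_hom_frob) (rule CHARs)
  obtain z b a where z: "z = (1 + b) * frob z + of_nat p ^ 5 * ?S ^ (p\<^sup>2 - 1) * frob (frob z)"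
    and z0: "coords z 0 = 1" and a: "\<And>i. a i \<in> rooted (5 * i - 2)"
    and b: "\<And>n. b - (\<Sum>i<n. descend i (a i)) \<in> ver_ideal n"
    by (rule series_solution) blast
  have TS: "?T * ?S = 1"
    by (simp add: fls_inverse_X[symmetric] flip: teich_mult)
  have T_eq: "?T = wmap ?\<iota> (teich fps_X)"
    by (simp add: wmap_teich[OF \<iota>.unital_hom_axioms])
  have p1: "p \<ge> 2"
    using p by (rule prime_ge_2_nat)
  \<comment> \<open>The multiplier is \<open>\<sigma>^L\<close> of \<open>[t] ^ (p - 1)\<close>. It
    clears every pole in \<open>rooted L\<close>, because exponents there are at most
    \<open>p ^ L\<close>, which is at most \<open>p ^ L * (p - 1)\<close> as
    \<open>p \<ge> 2\<close>.\<close>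
  have T_rooted: "\<exists>c. ?T ^ (p ^ L * (p - 1)) * r = wmap ?\<iota> c" if "r \<in> rooted L" for r L
    using that unfolding rooted_def
  proof induction
    case zspan_zero
    show ?case
      by (rule exI[of _ 0]) simp
  next
    case (zspan_gen r)
    then obtain m where r: "r = ?S ^ m" and m: "m \<le> p ^ L"
      by auto
    have "m \<le> p ^ L * (p - 1)"
      using m p1 by (metis One_nat_def Suc_1 diff_le_mono le_trans mult_le_mono2 mult_1_right diff_Suc_1)
    then have "?T ^ (p ^ L * (p - 1)) = ?T ^ (p ^ L * (p - 1) - m) * ?T ^ m"
      by (simp flip: power_add)
    then have "?T ^ (p ^ L * (p - 1)) * r = ?T ^ (p ^ L * (p - 1) - m) * (?T * ?S) ^ m"
      by (simp add: r power_mult_distrib mult.assoc)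
    also have "\<dots> = wmap ?\<iota> (teich fps_X ^ (p ^ L * (p - 1) - m))"
      by (simp add: TS W\<iota>.hom_power flip: T_eq)
    finally show ?case
      by blast
  next
    case (zspan_diff x y)
    then obtain c d where "?T ^ (p ^ L * (p - 1)) * x = wmap ?\<iota> c" "?T ^ (p ^ L * (p - 1)) * y = wmap ?\<iota> d"
      by blast
    then show ?case
      by (intro exI[of _ "c - d"]) (simp add: right_diff_distrib W\<iota>.hom_diff)
  qed
  \<comment> \<open>By the projection formula \<open>[t] ^ (p - 1)\<close> moves inside
    \<open>V ^ ?L\<close> as its image under \<open>\<sigma>^?L\<close>, where
    \<open>T_rooted\<close> applies. The filtration step is recorded so that the preimages can be
    summed.\<close>
  have "\<exists>c. c \<in> ver_ideal i \<and> ?T ^ (p - 1) * descend i (a i) = wmap ?\<iota> c" for i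
  proof -
    let ?L = "5 * i - 2"
    obtain c where c: "?T ^ (p ^ ?L * (p - 1)) * a i = wmap ?\<iota> c"
      using T_rooted[OF a] by blast
    have "?T ^ (p - 1) * descend i (a i) =
        of_nat p ^ (5 * i - ?L) * (ver ^^ ?L) ((frob ^^ ?L) (?T ^ (p - 1)) * a i)"
      unfolding descend_def by (subst mult.left_commute) (simp only: mult_ver_pow[OF CHARs(4)])
    also have "(frob ^^ ?L) (?T ^ (p - 1)) = ?T ^ (p ^ ?L * (p - 1))"
      by (simp only: frob_pow_teich_power[OF CHARs(4)] CHARs)
    also have "of_nat p ^ (5 * i - ?L) * (ver ^^ ?L) (?T ^ (p ^ ?L * (p - 1)) * a i) =
        wmap ?\<iota> (of_nat p ^ (5 * i - ?L) * (ver ^^ ?L) c)"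
      by (simp only: c W\<iota>.hom_mult W\<iota>.hom_power W\<iota>.hom_of_nat wmap_ver_pow[OF \<iota>.unital_hom_axioms])
    finally have "?T ^ (p - 1) * descend i (a i) = wmap ?\<iota> (of_nat p ^ (5 * i - ?L) * (ver ^^ ?L) c)" .
    moreover have "of_nat p ^ (5 * i - ?L) * (ver ^^ ?L) c \<in> ver_ideal (5 * i - ?L + ?L)"
      by (intro ver_ideal_mult CHARs ver_pow_in_ver_ideal
        of_nat_CHAR_power_in_ver_ideal[OF CHARs(3), unfolded CHARs(1)])
    then have "of_nat p ^ (5 * i - ?L) * (ver ^^ ?L) c \<in> ver_ideal i"
      using ver_ideal_mono[of i "5 * i - ?L + ?L"] by auto
    ultimately show ?thesis
      by blast
  qed
  then obtain c where cI: "\<And>i. c i \<in> ver_ideal i"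
    and c: "\<And>i. ?T ^ (p - 1) * descend i (a i) = wmap ?\<iota> (c i)"
    by metis
  obtain s where s: "\<And>n. s - (\<Sum>i<n. c i) \<in> ver_ideal n"
    using ver_adic_complete[OF cI] by blast
  \<comment> \<open>Both sides are limits of the same partial sums, since base change preserves the
    filtration.\<close>
  have "?T ^ (p - 1) * b = wmap ?\<iota> s"
  proof -
    have "?T ^ (p - 1) * b - wmap ?\<iota> s \<in> ver_ideal n" for n
    proof -
      have "?T ^ (p - 1) * b - wmap ?\<iota> s =
          ?T ^ (p - 1) * (b - (\<Sum>i<n. descend i (a i))) - wmap ?\<iota> (s - (\<Sum>i<n. c i))"
        by (simp add: W\<iota>.hom_diff W\<iota>.hom_sum right_diff_distrib sum_distrib_left flip: c)
      also have "\<dots> \<in> ver_ideal n"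
        by (intro ver_ideal_diff ver_ideal_mult_left CHARs b wmap_ver_ideal s) simp
      finally show ?thesis .
    qed
    then show ?thesis
      using ver_ideal_all_imp_zero[of "?T ^ (p - 1) * b - wmap ?\<iota> s"] by simp
  qed
  then have a': "wmap ?\<iota> (teich fps_X ^ (p - 1) + s) = ?T ^ (p - 1) * (1 + b)"
    by (simp add: W\<iota>.hom_add W\<iota>.hom_power T_eq ring_distribs)
  have frob_S: "frob ?S = ?S ^ p"
    unfolding frob_teich[OF CHARs(4)] CHARs(2) by (rule teich_power)
  have S: "?T ^ (p - 1) * ?S ^ p = ?S" "?S * ?S ^ (p\<^sup>2 - 1) = ?S ^ p\<^sup>2"
  proof -
    have "?S ^ p = ?S ^ (p - 1) * ?S"
      using p1 by (cases p) simp_all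
    then have "?T ^ (p - 1) * ?S ^ p = (?T * ?S) ^ (p - 1) * ?S"
      by (simp only: power_mult_distrib mult.assoc)
    then show "?T ^ (p - 1) * ?S ^ p = ?S"
      by (simp add: TS)
    have "p\<^sup>2 \<noteq> 0"
      using p1 by simp
    then show "?S * ?S ^ (p\<^sup>2 - 1) = ?S ^ p\<^sup>2"
      by (simp add: power_eq_if[of _ "p\<^sup>2"])
  qed
  have frob_x: "frob (?S * z) = ?S ^ p * frob z" "frob (frob (?S * z)) = ?S ^ p\<^sup>2 * frob (frob z)"
    by (simp_all add: frob.hom_mult frob.hom_power frob_S power2_eq_square power_mult)
  \<comment> \<open>Multiplying by \<open>S\<close> gives the equation for \<open>x = S z\<close>:
    write \<open>S\<close> as \<open>[t] ^ (p - 1) * S ^ p\<close> in the first term and merge it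
    with \<open>S ^ (p\<^sup>2 - 1)\<close> in the second; then \<open>S ^ p\<close> and
    \<open>S ^ p\<^sup>2\<close> are the factors produced by \<open>\<sigma>\<close> and
    \<open>\<sigma>^2\<close>.\<close>
  have "?S * z = ?S * ((1 + b) * frob z + of_nat p ^ 5 * ?S ^ (p\<^sup>2 - 1) * frob (frob z))"
    using z by simp
  also have "\<dots> = (?T ^ (p - 1) * ?S ^ p) * ((1 + b) * frob z) +
      of_nat p ^ 5 * ((?S * ?S ^ (p\<^sup>2 - 1)) * frob (frob z))"
    unfolding S(1) by (simp only: distrib_left mult_ac)
  also have "\<dots> = wmap ?\<iota> (teich fps_X ^ (p - 1) + s) * frob (?S * z) + of_nat p ^ 5 * frob (frob (?S * z))"
    unfolding S(2) a' frob_x(2) unfolding frob_x(1) by (simp only: mult_ac)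
  finally show ?thesis
  proof (rule that)
    show "coords (?S * z) 0 \<notin> range ?\<iota>"
      by (simp add: coords_mult_0 z0 fls_X_inv_notin_range)
  qed
qed

section \<open>The Witt ring and its free module of rank 2 as records\<close>

lemma witt_ring_simps [simp]:
  "carrier (witt_ring p) = UNIV" "\<one>\<^bsub>witt_ring p\<^esub> = witt_one" "\<zero>\<^bsub>witt_ring p\<^esub> = (\<lambda>_. 0)"
  "x \<oplus>\<^bsub>witt_ring p\<^esub> y = witt_add p x y" "x \<otimes>\<^bsub>witt_ring p\<^esub> y = witt_mult p x y"
  by (simp_all add: witt_ring_def witt_one_def witt_add_def witt_mult_def)

lemma witt_mult_one_right: "prime p \<Longrightarrow> witt_mult p x witt_one = x"
  using witt_mult_one[of p x] by (simp add: witt_mult_commute)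

lemma witt_add_zero_right: "prime p \<Longrightarrow> witt_add p x (\<lambda>_. 0) = x"
  using witt_add_zero[of p x] by (simp add: witt_add_commute)

lemma witt_mult_left_commute:
  "prime p \<Longrightarrow> witt_mult p x (witt_mult p y z) = witt_mult p y (witt_mult p x z)"
  by (metis witt_mult_assoc witt_mult_commute)

lemma witt_add_left_commute:
  "prime p \<Longrightarrow> witt_add p x (witt_add p y z) = witt_add p y (witt_add p x z)"
  by (metis witt_add_assoc witt_add_commute)

lemma cring_witt_ring:
  assumes "prime p"
  shows "cring (witt_ring p :: 'a::comm_ring_1 witt ring)"
proof (rule cringI)
  show "abelian_group (witt_ring p :: 'a witt ring)"
  proof (rule abelian_groupI)
    fix x :: "'a witt"
    show "\<exists>y\<in>carrier (witt_ring p). y \<oplus>\<^bsub>witt_ring p\<^esub> x = \<zero>\<^bsub>witt_ring p\<^esub>"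
      by (rule bexI[of _ "witt_neg p x"]) (simp_all add: witt_add_neg assms)
  qed (simp_all add: witt_add_assoc witt_add_commute witt_add_left_commute witt_add_zero
    witt_add_zero_right assms)
  show "comm_monoid (witt_ring p :: 'a witt ring)"
    by (rule comm_monoidI) (simp_all add: witt_mult_assoc witt_mult_commute witt_mult_left_commute
      witt_mult_one witt_mult_one_right assms)
qed (simp add: witt_distrib assms)

definition witt_square :: "nat \<Rightarrow> ('a::comm_ring_1 witt, 'a witt \<times> 'a witt) module" where
  "witt_square p =
     \<lparr>carrier = UNIV, monoid.mult = undefined, one = undefined,
      ring.zero = (\<lambda>_. 0, \<lambda>_. 0),
      add = (\<lambda>x y. (witt_add p (fst x) (fst y), witt_add p (snd x) (snd y))),
      module.smult = (\<lambda>r x. (witt_mult p r (fst x), witt_mult p r (snd x)))\<rparr>"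

lemma witt_square_simps [simp]:
  "carrier (witt_square p) = UNIV"
  "\<zero>\<^bsub>witt_square p\<^esub> = (\<lambda>_. 0, \<lambda>_. 0)"
  "x \<oplus>\<^bsub>witt_square p\<^esub> y = (witt_add p (fst x) (fst y), witt_add p (snd x) (snd y))"
  "r \<odot>\<^bsub>witt_square p\<^esub> x = (witt_mult p r (fst x), witt_mult p r (snd x))"
  by (simp_all add: witt_square_def)

lemma abelian_group_witt_square:
  assumes "prime p"
  shows "abelian_group (witt_square p :: ('a::comm_ring_1 witt, _) module)"
proof (rule abelian_groupI)
  fix x :: "'a witt \<times> 'a witt"
  show "\<exists>y\<in>carrier (witt_square p). y \<oplus>\<^bsub>witt_square p\<^esub> x = \<zero>\<^bsub>witt_square p\<^esub>"
    by (rule bexI[of _ "(witt_neg p (fst x), witt_neg p (snd x))"]) (simp_all add: witt_add_neg assms)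
qed (simp_all add: witt_add_assoc witt_add_commute witt_add_left_commute witt_add_zero
    witt_add_zero_right assms)

lemma witt_distrib_right:
  "prime p \<Longrightarrow> witt_mult p z (witt_add p x y) = witt_add p (witt_mult p z x) (witt_mult p z y)"
  by (simp add: witt_distrib witt_mult_commute[of p z])

lemma module_witt_square:
  assumes "prime p"
  shows "module (witt_ring p) (witt_square p :: ('a::comm_ring_1 witt, _) module)"
proof (rule moduleI)
  show "cring (witt_ring p :: 'a witt ring)" "abelian_group (witt_square p :: ('a witt, _) module)"
    using assms by (rule cring_witt_ring, rule abelian_group_witt_square)
qed (simp_all add: witt_mult_assoc witt_distrib witt_distrib_right witt_mult_one assms)

lemma witt_mult_zero_right: "prime p \<Longrightarrow> witt_mult p x (\<lambda>_. 0) = (\<lambda>_. 0 :: 'a::comm_ring_1)"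
proof -
  assume "prime p"
  then interpret cring "witt_ring p :: 'a witt ring"
    by (rule cring_witt_ring)
  show ?thesis
    using r_null[of x] by simp
qed

lemma free_of_rank_witt_square:
  assumes p: "prime p"
  shows "free_of_rank (witt_ring p) (witt_square p :: ('a::comm_ring_1 witt, _) module) 2"
proof -
  let ?M = "witt_square p :: ('a witt, _) module"
  interpret abelian_group ?M
    by (rule abelian_group_witt_square[OF p])
  define b :: "nat \<Rightarrow> 'a witt \<times> 'a witt"
    where "b i = (if i = 0 then (witt_one, \<lambda>_. 0) else (\<lambda>_. 0, witt_one))" for i
  have sum: "(\<Oplus>\<^bsub>?M\<^esub>i\<in>{..<2::nat}. c i \<odot>\<^bsub>?M\<^esub> b i) = (c 0, c 1)" for c
  proof -
    have "{..<2::nat} = {0, 1}"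
      by auto
    then have "(\<Oplus>\<^bsub>?M\<^esub>i\<in>{..<2::nat}. c i \<odot>\<^bsub>?M\<^esub> b i) = c 0 \<odot>\<^bsub>?M\<^esub> b 0 \<oplus>\<^bsub>?M\<^esub> (c 1 \<odot>\<^bsub>?M\<^esub> b 1 \<oplus>\<^bsub>?M\<^esub> \<zero>\<^bsub>?M\<^esub>)"
      by (simp only: finsum_insert finsum_empty finite.intros Pi_UNIV witt_square_simps(1))
        (simp add: finsum_insert)
    then show ?thesis
      by (simp add: b_def witt_mult_zero_right witt_mult_one_right witt_add_zero witt_add_zero_right p)
  qed
  have "\<exists>!c. c \<in> {..<2} \<rightarrow>\<^sub>E carrier (witt_ring p) \<and> m = (\<Oplus>\<^bsub>?M\<^esub>i\<in>{..<2::nat}. c i \<odot>\<^bsub>?M\<^esub> b i)" for m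
    unfolding sum
  proof (rule ex1I)
    show "(\<lambda>i\<in>{..<2::nat}. if i = 0 then fst m else snd m) \<in> {..<2} \<rightarrow>\<^sub>E carrier (witt_ring p) \<and>
        m = ((\<lambda>i\<in>{..<2::nat}. if i = 0 then fst m else snd m) 0, (\<lambda>i\<in>{..<2::nat}. if i = 0 then fst m else snd m) 1)"
      by simp
  next
    fix c :: "nat \<Rightarrow> 'a witt"
    assume c: "c \<in> {..<2} \<rightarrow>\<^sub>E carrier (witt_ring p) \<and> m = (c 0, c 1)"
    show "c = (\<lambda>i\<in>{..<2::nat}. if i = 0 then fst m else snd m)"
    proof
      fix i :: nat
      consider "i = 0" | "i = 1" | "i \<ge> 2"
        by linarith
      then show "c i = (\<lambda>i\<in>{..<2::nat}. if i = 0 then fst m else snd m) i"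
        by cases (use c in \<open>auto simp: PiE_iff extensional_def\<close>)
    qed
  qed
  then show ?thesis
    unfolding free_of_rank_def by (intro bexI[of _ b]) auto
qed

lemma frag_eval_cmul: "frag_eval g (frag_cmul n a) = of_int n * frag_eval g a"
  by (simp add: frag_eval_superset[of "Poly_Mapping.keys a"] keys_cmul sum_distrib_left mult.assoc)

section \<open>Base change of a free module of rank 2\<close>

text \<open>Covers both base changes at once: along \<open>\<sigma>\<close> and along the inclusion
  into \<open>W(k((t)))\<close>. The same map occurs twice, as \<open>\<phi>\<close> on bare
  sequences, where the tensor product is defined, and as \<open>\<Phi>\<close> on the ring type; the
  conditions on \<open>wprime\<close> make the two arithmetics agree.\<close>

locale witt_base_change =
  fixes p :: nat and \<Phi> :: "'a::comm_ring_1 witt_vec \<Rightarrow> 'b::comm_ring_1 witt_vec" and \<phi> :: "'a witt \<Rightarrow> 'b witt"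
  assumes hom_\<Phi>: "unital_hom \<Phi>" and wprime_a: "wprime TYPE('a) = p" and wprime_b: "wprime TYPE('b) = p"
    and \<phi>: "\<phi> x = coords (\<Phi> (Witt x))"
begin

sublocale unital_hom \<Phi>
  by (rule hom_\<Phi>)

lemma prime_p: "prime p"
  using prime_wprime[where 'a = 'a] by (simp add: wprime_a)

lemma Witt_add: "Witt (witt_add p x y) = (Witt x + Witt y :: 'a witt_vec)"
  "Witt (witt_add p u v) = (Witt u + Witt v :: 'b witt_vec)"
  by (simp_all add: plus_witt_vec_def wprime_a wprime_b)

lemma Witt_mult: "Witt (witt_mult p x y) = (Witt x * Witt y :: 'a witt_vec)"
  "Witt (witt_mult p u v) = (Witt u * Witt v :: 'b witt_vec)"
  by (simp_all add: times_witt_vec_def wprime_a wprime_b)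

lemma Witt_zero: "Witt (\<lambda>_. 0) = 0"
  by (simp add: zero_witt_vec_def)

lemma Witt_one: "Witt witt_one = 1"
  by (simp add: one_witt_vec_def)

abbreviation "null \<equiv> tensor_null (witt_ring p) (witt_ring p) \<phi> (witt_square p)"
abbreviation "cls \<equiv> tensor_class (witt_ring p) (witt_ring p) \<phi> (witt_square p)"
abbreviation "rels \<equiv> tensor_rels (witt_ring p) (witt_ring p) \<phi> (witt_square p)"
abbreviation "bc \<equiv> base_change (witt_ring p) (witt_ring p) \<phi> (witt_square p)"
abbreviation "G \<equiv> free_Abelian_group (UNIV :: (('a witt \<times> 'a witt) \<times> 'b witt) set)"

text \<open>The coordinates of a representative of a tensor with respect to the basis \<open>e1 \<otimes> 1, e2 \<otimes> 1\<close>.\<close>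

definition tcoord1 :: "((('a witt \<times> 'a witt) \<times> 'b witt) \<Rightarrow>\<^sub>0 int) \<Rightarrow> 'b witt_vec" where
  "tcoord1 = frag_eval (\<lambda>(m, s). \<Phi> (Witt (fst m)) * Witt s)"

definition tcoord2 :: "((('a witt \<times> 'a witt) \<times> 'b witt) \<Rightarrow>\<^sub>0 int) \<Rightarrow> 'b witt_vec" where
  "tcoord2 = frag_eval (\<lambda>(m, s). \<Phi> (Witt (snd m)) * Witt s)"

lemma tcoord_of: "tcoord1 (frag_of (m, s)) = \<Phi> (Witt (fst m)) * Witt s" "tcoord2 (frag_of (m, s)) = \<Phi> (Witt (snd m)) * Witt s"
  unfolding tcoord1_def tcoord2_def frag_eval_frag_of by simp_all

lemma tcoord_add: "tcoord1 (a + b) = tcoord1 a + tcoord1 b" "tcoord2 (a + b) = tcoord2 a + tcoord2 b"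
  by (simp_all add: tcoord1_def tcoord2_def frag_eval_add)

lemma tcoord_diff: "tcoord1 (a - b) = tcoord1 a - tcoord1 b" "tcoord2 (a - b) = tcoord2 a - tcoord2 b"
  by (simp_all add: tcoord1_def tcoord2_def frag_eval_diff)

lemma tcoord_zero [simp]: "tcoord1 0 = 0" "tcoord2 0 = 0"
  by (simp_all add: tcoord1_def tcoord2_def)

lemma tcoord_minus: "tcoord1 (- a) = - tcoord1 a" "tcoord2 (- a) = - tcoord2 a"
  using tcoord_diff[of 0 a] by simp_all

lemma tcoord_cmul: "tcoord1 (frag_cmul n a) = of_int n * tcoord1 a" "tcoord2 (frag_cmul n a) = of_int n * tcoord2 a"
  by (simp_all add: tcoord1_def tcoord2_def frag_eval_cmul)

lemma null_eq: "null = generate G rels"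
  by (simp add: tensor_null_def)

lemma tcoord_rels: "a \<in> rels \<Longrightarrow> tcoord1 a = 0 \<and> tcoord2 a = 0"
  unfolding tensor_rels_def
  by (elim UnE CollectE exE conjE; hypsubst; simp add: tcoord_diff tcoord_of Witt_add Witt_mult hom_add hom_mult \<phi>;
    simp add: algebra_simps)

lemma null_imp: "a \<in> null \<Longrightarrow> tcoord1 a = 0 \<and> tcoord2 a = 0"
  unfolding null_eq
  by (induction rule: generate.induct) (auto simp: tcoord_add tcoord_minus tcoord_rels)

lemma subgroup_null: "subgroup null G"
  unfolding null_eq by (rule group.generate_is_subgroup) (simp_all add: subset_iff)

lemma null_add: "a \<in> null \<Longrightarrow> b \<in> null \<Longrightarrow> a + b \<in> null"
  using subgroup.m_closed[OF subgroup_null, of a b] by simp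

lemma null_minus: "a \<in> null \<Longrightarrow> - a \<in> null"
  using subgroup.m_inv_closed[OF subgroup_null, of a] by simp

lemma null_diff: "a \<in> null \<Longrightarrow> b \<in> null \<Longrightarrow> a - b \<in> null"
  using null_add[of a "- b"] null_minus[of b] by simp

lemma rels_null: "a \<in> rels \<Longrightarrow> a \<in> null"
  unfolding null_eq by (rule generate.incl)

abbreviation (input) "e1 \<equiv> (witt_one, \<lambda>_. 0)"
abbreviation (input) "e2 \<equiv> (\<lambda>_. 0, witt_one)"

definition normal_form :: "((('a witt \<times> 'a witt) \<times> 'b witt) \<Rightarrow>\<^sub>0 int) \<Rightarrow>
    ((('a witt \<times> 'a witt) \<times> 'b witt) \<Rightarrow>\<^sub>0 int)" where
  "normal_form a = frag_of (e1, coords (tcoord1 a)) + frag_of (e2, coords (tcoord2 a))"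

lemma null_pair_add: "frag_of (m, coords (s + s')) - frag_of (m, coords s) - frag_of (m, coords s') \<in> null"
proof (rule rels_null)
  have "coords (s + s') = witt_add p (coords s) (coords s')"
    by (simp add: plus_witt_vec_def wprime_b)
  then show "frag_of (m, coords (s + s')) - frag_of (m, coords s) - frag_of (m, coords s') \<in> rels"
    unfolding tensor_rels_def
    by (intro UnI1[OF UnI2] CollectI exI[of _ m] exI[of _ "coords s"] exI[of _ "coords s'"]) simp
qed

text \<open>Additivity holds only modulo the relations, since a formal sum does not merge pairs with
  the same first entry.\<close>

lemma normal_form_diff: "normal_form (a - b) - (normal_form a - normal_form b) \<in> null"
proof -
  define E where "E m s s' = frag_of (m, coords (s + s')) - frag_of (m, coords s) - frag_of (m, coords s')"
    for m :: "'a witt \<times> 'a witt" and s s' :: "'b witt_vec"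
  have "normal_form (a - b) - (normal_form a - normal_form b) = - (E e1 (tcoord1 (a - b)) (tcoord1 b) + E e2 (tcoord2 (a - b)) (tcoord2 b))"
    by (simp add: E_def normal_form_def tcoord_diff)
  also have "\<dots> \<in> null"
    unfolding E_def by (intro null_minus null_add null_pair_add)
  finally show ?thesis .
qed

text \<open>On a generator the relations give \<open>m \<otimes> s = e1 \<otimes> \<phi> m1 s + e2
  \<otimes> \<phi> m2 s\<close>; the general case follows by additivity modulo
  \<open>null\<close>.\<close>

lemma normal_form_null: "a - normal_form a \<in> null"
proof (induction a rule: frag_induction[OF subset_UNIV])
  case 1
  \<comment> \<open>The normal form of 0 is a nonzero formal sum. The additivity relation for
    \<open>0 + 0\<close> is minus the generator \<open>(m, 0)\<close>, so this sum lies in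
    \<open>null\<close>.\<close>
  have "frag_of (m, coords (0 :: 'b witt_vec)) \<in> null" for m
    using null_minus[OF null_pair_add[of m 0 0]] by simp
  then have "- (frag_of (e1, coords 0) + frag_of (e2, coords (0 :: 'b witt_vec))) \<in> null"
    by (intro null_minus null_add)
  then show ?case
    by (simp add: normal_form_def)
next
  case (2 ms)
  obtain m1 m2 s where ms: "ms = ((m1, m2), s)"
    by (metis surj_pair)
  have "frag_of ((m1, m2), s) - frag_of ((m1, \<lambda>_. 0), s) - frag_of ((\<lambda>_. 0, m2), s) \<in> rels"
    unfolding tensor_rels_def
    by (rule UnI1, rule UnI1, rule CollectI, rule exI[of _ "(m1, \<lambda>_. 0)"], rule exI[of _ "(\<lambda>_. 0, m2)"], rule exI[of _ s])
      (simp add: witt_add_zero witt_add_zero_right prime_p)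
  moreover have "frag_of ((m1, \<lambda>_. 0), s) - frag_of (e1, witt_mult p (\<phi> m1) s) \<in> rels"
    unfolding tensor_rels_def
    by (rule UnI2, rule CollectI, rule exI[of _ m1], rule exI[of _ e1], rule exI[of _ s])
      (simp add: witt_mult_one_right witt_mult_zero_right prime_p)
  moreover have "frag_of ((\<lambda>_. 0, m2), s) - frag_of (e2, witt_mult p (\<phi> m2) s) \<in> rels"
    unfolding tensor_rels_def
    by (rule UnI2, rule CollectI, rule exI[of _ m2], rule exI[of _ e2], rule exI[of _ s])
      (simp add: witt_mult_one_right witt_mult_zero_right prime_p)
  ultimately have "(frag_of ((m1, m2), s) - frag_of ((m1, \<lambda>_. 0), s) - frag_of ((\<lambda>_. 0, m2), s)) +
      (frag_of ((m1, \<lambda>_. 0), s) - frag_of (e1, witt_mult p (\<phi> m1) s)) +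
      (frag_of ((\<lambda>_. 0, m2), s) - frag_of (e2, witt_mult p (\<phi> m2) s)) \<in> null"
    by (intro null_add rels_null)
  moreover have "coords (\<Phi> (Witt m) * Witt s) = witt_mult p (\<phi> m) s" for m
    by (simp add: times_witt_vec_def wprime_b \<phi>)
  ultimately show ?case
    unfolding normal_form_def ms tcoord_of fst_conv snd_conv by (simp add: algebra_simps)
next
  case (3 a b)
  have "(a - normal_form a) - (b - normal_form b) - (normal_form (a - b) - (normal_form a - normal_form b)) \<in> null"
    by (intro null_diff normal_form_diff 3)
  then show ?case
    by (simp add: algebra_simps)
qed

text \<open>The normal form depends only on the two coordinates, so an element with zero coordinates
  shares its normal form with 0. Hence classes of tensors can be computed with as pairs of Witt
  vectors.\<close>

lemma null_iff: "a \<in> null \<longleftrightarrow> tcoord1 a = 0 \<and> tcoord2 a = 0"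
proof
  assume "tcoord1 a = 0 \<and> tcoord2 a = 0"
  then have "normal_form a = normal_form 0"
    by (simp add: normal_form_def)
  then have "(a - normal_form a) - (0 - normal_form 0) = a"
    by simp
  then show "a \<in> null"
    using null_diff[OF normal_form_null[of a] normal_form_null[of 0]] by simp
qed (rule null_imp)

lemma cls_eq: "cls a = {b. b - a \<in> null}"
proof -
  have "cls a = (\<lambda>x. x + a) ` null"
    by (auto simp: tensor_class_def r_coset_def)
  also have "\<dots> = {b. b - a \<in> null}"
    by (auto simp: image_iff) (metis diff_add_cancel)
  finally show ?thesis .
qed

lemma in_cls_iff: "b \<in> cls a \<longleftrightarrow> tcoord1 b = tcoord1 a \<and> tcoord2 b = tcoord2 a"
  by (simp add: cls_eq null_iff tcoord_diff)

lemma cls_eq_iff: "cls a = cls b \<longleftrightarrow> tcoord1 a = tcoord1 b \<and> tcoord2 a = tcoord2 b"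
  by (auto simp: set_eq_iff in_cls_iff)

lemma carrier_bc: "carrier bc = range cls"
  by (auto simp: base_change_def Let_def carrier_FactGroup tensor_class_def)

lemma add_bc: "cls a \<oplus>\<^bsub>bc\<^esub> cls b = cls (a + b)"
proof -
  have "cls a \<oplus>\<^bsub>bc\<^esub> cls b = {x + y |x y. x \<in> cls a \<and> y \<in> cls b}"
    by (auto simp: base_change_def Let_def set_mult_def)
  also have "\<dots> = cls (a + b)"
  proof (intro equalityI subsetI)
    fix c
    assume "c \<in> cls (a + b)"
    then have "c - b \<in> cls a" "b \<in> cls b"
      by (auto simp: in_cls_iff tcoord_add tcoord_diff)
    then show "c \<in> {x + y |x y. x \<in> cls a \<and> y \<in> cls b}"
      by (intro CollectI exI[of _ "c - b"] exI[of _ b]) simp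
  qed (auto simp: in_cls_iff tcoord_add)
  finally show ?thesis .
qed

lemma zero_bc: "\<zero>\<^bsub>bc\<^esub> = cls 0"
  by (simp add: base_change_def Let_def cls_eq)

lemma tensor_map_cls:
  assumes "\<And>a b. tcoord1 a = tcoord1 b \<Longrightarrow> tcoord2 a = tcoord2 b \<Longrightarrow>
    tcoord1 (frag_extend (\<lambda>(m, s). frag_of (f m, g s)) a) = tcoord1 (frag_extend (\<lambda>(m, s). frag_of (f m, g s)) b) \<and>
    tcoord2 (frag_extend (\<lambda>(m, s). frag_of (f m, g s)) a) = tcoord2 (frag_extend (\<lambda>(m, s). frag_of (f m, g s)) b)"
  shows "tensor_map (witt_ring p) (witt_ring p) \<phi> (witt_square p) f g (cls a) =
    cls (frag_extend (\<lambda>(m, s). frag_of (f m, g s)) a)"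
proof -
  let ?E = "frag_extend (\<lambda>(m, s). frag_of (f m, g s))"
  have "cls (?E b) = cls (?E a)" if "b \<in> cls a" for b
    unfolding cls_eq_iff by (rule assms) (use that in \<open>simp_all only: in_cls_iff\<close>)
  then have "(\<Union>b\<in>cls a. cls (?E b)) = (\<Union>b\<in>cls a. cls (?E a))"
    by (rule SUP_cong[OF refl])
  moreover have "cls a \<noteq> {}"
    using in_cls_iff[of a a] by blast
  ultimately show ?thesis
    unfolding tensor_map_def by simp
qed

lemma smult_bc:
  "r \<odot>\<^bsub>bc\<^esub> cls a = cls (frag_extend (\<lambda>(m, s). frag_of (m, witt_mult p r s)) a)"
  "tcoord1 (frag_extend (\<lambda>(m, s). frag_of (m, witt_mult p r s)) a) = Witt r * tcoord1 a"
  "tcoord2 (frag_extend (\<lambda>(m, s). frag_of (m, witt_mult p r s)) a) = Witt r * tcoord2 a"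
proof -
  have *: "tcoord1 (frag_extend (\<lambda>(m, s). frag_of (m, witt_mult p r s)) a) = Witt r * tcoord1 a \<and>
      tcoord2 (frag_extend (\<lambda>(m, s). frag_of (m, witt_mult p r s)) a) = Witt r * tcoord2 a" for a
  proof (induction a rule: frag_induction[OF subset_UNIV])
    case (2 ms)
    then show ?case
      by (cases ms) (simp only: frag_extend_of prod.case tcoord_of Witt_mult mult.left_commute simp_thms)
  next
    case (3 a b)
    then show ?case
      by (simp only: frag_extend_diff tcoord_diff right_diff_distrib simp_thms)
  qed simp
  then show "tcoord1 (frag_extend (\<lambda>(m, s). frag_of (m, witt_mult p r s)) a) = Witt r * tcoord1 a"
    "tcoord2 (frag_extend (\<lambda>(m, s). frag_of (m, witt_mult p r s)) a) = Witt r * tcoord2 a"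
    by simp_all
  have "r \<odot>\<^bsub>bc\<^esub> X = tensor_map (witt_ring p) (witt_ring p) \<phi> (witt_square p) (\<lambda>m. m) (witt_mult p r) X" for X
    by (simp add: base_change_def Let_def)
  then show "r \<odot>\<^bsub>bc\<^esub> cls a = cls (frag_extend (\<lambda>(m, s). frag_of (m, witt_mult p r s)) a)"
    by (simp only: tensor_map_cls *)
qed

text \<open>Powers do not see the carrier, so \<open>K\<close> may be the kernel of the
  isogeny.\<close>

lemma pow_bc: "cls a [^]\<^bsub>add_monoid (bc\<lparr>carrier := K\<rparr>)\<^esub> n = cls (frag_cmul (int n) a)"
proof (induction n)
  case 0
  then show ?case
    by (simp add: zero_bc)
next
  case (Suc n)
  then show ?case
    by (simp add: nat_pow_def add_bc frag_cmul_distrib add.commute)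
qed

end

section \<open>The isogeny and its fixed vector\<close>

theorem proposition6p1:
  fixes p :: nat
  assumes "CHAR('k::alg_closed_field) = p" and "p > 0"
  shows "\<exists>(M :: ('k fps witt, 'k fps witt \<times> 'k fps witt) module)
            (F :: ((('k fps witt \<times> 'k fps witt) \<times> 'k fps witt) \<Rightarrow>\<^sub>0 int) set \<Rightarrow> 'k fps witt \<times> 'k fps witt)
            v.
           module (W_fps p) M \<and> free_of_rank (W_fps p) M 2 \<and>
           isogeny p (W_fps p) (sigma_pullback p M) M F \<and>
           v \<in> carrier (generic_module p M) - to_generic p M ` carrier M \<and>
           frob_generic p M F v = v"
proof -
  have p: "prime p"
    using assms prime_CHAR_semidom[where 'a = 'k] by simp
  have prime_CHARs: "prime CHAR('k fps)" "prime CHAR('k fls)"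
    using assms p by simp_all
  have wprimes: "wprime TYPE('k fps) = p" "wprime TYPE('k fls) = p"
    using assms p by (simp_all add: wprime_def)
  let ?\<iota> = "fps_to_fls :: 'k fps \<Rightarrow> 'k fls"
  let ?M = "witt_square p :: ('k fps witt, 'k fps witt \<times> 'k fps witt) module"
  interpret \<iota>: unital_hom ?\<iota>
    by (rule unital_hom_fps_to_fls)
  interpret sig: witt_base_change p "frob :: 'k fps witt_vec \<Rightarrow> _" "witt_frob p"
    by (rule witt_base_change.intro[OF unital_hom_frob[OF prime_CHARs(1)]])
      (simp_all add: wprimes frob_def witt_frob_def witt_map_def assms(1))
  have \<iota>_hom: "unital_hom (wmap ?\<iota>)"
    by (rule wmap_hom[OF \<iota>.unital_hom_axioms]) simp
  interpret gen: witt_base_change p "wmap ?\<iota>" "witt_map ?\<iota>"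
    by (rule witt_base_change.intro[OF \<iota>_hom]) (simp_all add: wprimes wmap_def witt_map_def)
  interpret frob_K: unital_hom "frob :: 'k fls witt_vec \<Rightarrow> _"
    by (rule unital_hom_frob) (rule prime_CHARs)
  have \<iota>_frob: "wmap ?\<iota> (frob x) = frob (wmap ?\<iota> x)" for x
    by (simp add: wmap_def frob_def \<iota>.hom_power)
  have Witt_frob: "Witt (witt_frob p s) = frob (Witt s :: 'k fls witt_vec)" for s
    by (simp add: frob_def witt_frob_def witt_map_def assms(1))
  obtain x :: "'k fls witt_vec" and a :: "'k fps witt_vec" where
    x: "x = wmap ?\<iota> a * frob x + of_nat p ^ 5 * frob (frob x)" and x0: "coords x 0 \<notin> range ?\<iota>"
    by (rule slope_equation_solution[OF assms(1) p])
  \<comment> \<open>On coordinates of the pullback \<open>F\<close> is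
    \<open>(u, v) \<mapsto> (a u + v, p ^ 5 u)\<close>. The chosen representative is immaterial, as
    the coordinates depend only on the class.\<close>
  define F :: "((('k fps witt \<times> 'k fps witt) \<times> 'k fps witt) \<Rightarrow>\<^sub>0 int) set \<Rightarrow> 'k fps witt \<times> 'k fps witt"
    where "F X = (let c = SOME c. c \<in> X in
      (coords (a * sig.tcoord1 c + sig.tcoord2 c), coords (of_nat p ^ 5 * sig.tcoord1 c)))" for X
  have F: "F (sig.cls c) = (coords (a * sig.tcoord1 c + sig.tcoord2 c), coords (of_nat p ^ 5 * sig.tcoord1 c))" for c
  proof -
    have "c \<in> sig.cls c"
      by (simp add: sig.in_cls_iff)
    then have "(SOME c'. c' \<in> sig.cls c) \<in> sig.cls c"
      by (rule someI)
    then show ?thesis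
      unfolding F_def Let_def by (simp only: sig.in_cls_iff)
  qed
  have coords_add: "coords (u + v) = witt_add p (coords u) (coords v)"
    and coords_mult: "coords (u * v) = witt_mult p (coords u) (coords v)" for u v :: "'k fps witt_vec"
    by (simp_all add: plus_witt_vec_def times_witt_vec_def wprimes)
  have coords_eq_0: "coords u = (\<lambda>_. 0) \<longleftrightarrow> u = 0" for u :: "'k fps witt_vec"
    by (metis Witt_coords coords_zero ext sig.Witt_zero)
  have pullback: "sigma_pullback p ?M = sig.bc"
    by (simp add: sigma_pullback_def)
  have hom: "F \<in> module_hom_set (witt_ring p) sig.bc ?M"
    unfolding module_hom_set_def
  proof (intro CollectI conjI ballI)
    fix X Y
    assume "X \<in> carrier sig.bc" "Y \<in> carrier sig.bc"
    then obtain b c where XY: "X = sig.cls b" "Y = sig.cls c"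
      by (auto simp: sig.carrier_bc)
    show "F (X \<oplus>\<^bsub>sig.bc\<^esub> Y) = F X \<oplus>\<^bsub>?M\<^esub> F Y"
      unfolding XY sig.add_bc F by (simp add: sig.tcoord_add algebra_simps flip: coords_add)
  next
    fix r :: "'k fps witt" and X
    assume "X \<in> carrier sig.bc"
    then obtain b where X: "X = sig.cls b"
      by (auto simp: sig.carrier_bc)
    have scale: "coords (Witt r * u) = witt_mult p r (coords u)" for u :: "'k fps witt_vec"
      by (simp add: coords_mult)
    show "F (r \<odot>\<^bsub>sig.bc\<^esub> X) = r \<odot>\<^bsub>?M\<^esub> F X"
      unfolding X sig.smult_bc(1) F sig.smult_bc(2,3) by (simp add: algebra_simps flip: scale)
  qed simp
  \<comment> \<open>On the kernel the second component says that \<open>p ^ 5\<close> kills the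
    first coordinate; \<open>p ^ 5\<close> times the first component then shows the same for the
    second.\<close>
  have ker: "killed_by_power p (add_monoid (sig.bc\<lparr>carrier := a_kernel sig.bc ?M F\<rparr>))"
    unfolding killed_by_power_def
  proof (intro exI[of _ 5] ballI)
    fix X
    assume "X \<in> carrier (add_monoid (sig.bc\<lparr>carrier := a_kernel sig.bc ?M F\<rparr>))"
    then have "X \<in> carrier sig.bc" "F X = (\<lambda>_. 0, \<lambda>_. 0)"
      by (simp_all add: a_kernel_def kernel_def)
    then obtain c where X: "X = sig.cls c" and c: "a * sig.tcoord1 c + sig.tcoord2 c = 0" "of_nat p ^ 5 * sig.tcoord1 c = 0"
      by (auto simp: sig.carrier_bc F coords_eq_0)
    have "of_nat p ^ 5 * sig.tcoord2 c = of_nat p ^ 5 * (a * sig.tcoord1 c + sig.tcoord2 c) - a * (of_nat p ^ 5 * sig.tcoord1 c)"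
      by (simp add: algebra_simps)
    then have "of_nat p ^ 5 * sig.tcoord2 c = 0"
      by (simp only: c mult_zero_right diff_self)
    then show "X [^]\<^bsub>add_monoid (sig.bc\<lparr>carrier := a_kernel sig.bc ?M F\<rparr>)\<^esub> (p ^ 5) =
        \<one>\<^bsub>add_monoid (sig.bc\<lparr>carrier := a_kernel sig.bc ?M F\<rparr>)\<^esub>"
      using c(2) unfolding X sig.pow_bc by (simp add: sig.zero_bc sig.cls_eq_iff sig.tcoord_cmul)
  qed
  have image: "F ` carrier sig.bc = {(coords (a * u + v), coords (of_nat p ^ 5 * u)) |u v. True}" (is "_ = ?H")
  proof (intro equalityI subsetI)
    fix m
    assume "m \<in> F ` carrier sig.bc"
    then obtain d where "m = (coords (a * sig.tcoord1 d + sig.tcoord2 d), coords (of_nat p ^ 5 * sig.tcoord1 d))"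
      by (auto simp: sig.carrier_bc F)
    then show "m \<in> ?H"
      by blast
  next
    fix m
    assume "m \<in> ?H"
    then obtain u v where m: "m = (coords (a * u + v), coords (of_nat p ^ 5 * u))"
      by blast
    let ?c = "frag_of ((witt_one, \<lambda>_. 0), coords u) + frag_of ((\<lambda>_. 0, witt_one), coords v)"
    have "F (sig.cls ?c) = m"
      by (simp add: F sig.tcoord_add sig.tcoord_of sig.Witt_one sig.Witt_zero m)
    then show "m \<in> F ` carrier sig.bc"
      unfolding sig.carrier_bc by blast
  qed
  have coker: "killed_by_power p (?M A_Mod (F ` carrier sig.bc))"
    unfolding killed_by_power_def A_FactGroup_def
  proof (intro exI[of _ 5] ballI)
    interpret M: abelian_group ?M
      by (rule abelian_group_witt_square[OF p])
    have "subgroup ?H (add_monoid ?M)"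
    proof (rule group.subgroupI[OF M.a_group])
      fix m
      assume "m \<in> ?H"
      then obtain u v where m: "m = (coords (a * u + v), coords (of_nat p ^ 5 * u))"
        by blast
      have "inv\<^bsub>add_monoid ?M\<^esub> m = (coords (a * (- u) + - v), coords (of_nat p ^ 5 * (- u)))"
        by (rule group.inv_equality[OF M.a_group])
          (simp_all add: m coords_eq_0 flip: coords_add)
      then show "inv\<^bsub>add_monoid ?M\<^esub> m \<in> ?H"
        by blast
    next
      fix m n
      assume "m \<in> ?H" "n \<in> ?H"
      then obtain u v u' v' where m: "m = (coords (a * u + v), coords (of_nat p ^ 5 * u))"
        "n = (coords (a * u' + v'), coords (of_nat p ^ 5 * u'))"
        by blast
      have "m \<otimes>\<^bsub>add_monoid ?M\<^esub> n = (coords (a * (u + u') + (v + v')), coords (of_nat p ^ 5 * (u + u')))"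
        by (simp add: m algebra_simps flip: coords_add)
      then show "m \<otimes>\<^bsub>add_monoid ?M\<^esub> n \<in> ?H"
        by blast
    qed auto
    then have normal: "F ` carrier sig.bc \<lhd> add_monoid ?M"
      unfolding image by (rule comm_group.subgroup_imp_normal[OF M.a_comm_group])
    interpret N: normal "F ` carrier sig.bc" "add_monoid ?M"
      by (rule normal)
    fix X
    assume "X \<in> carrier (add_monoid ?M Mod F ` carrier sig.bc)"
    then obtain m where X: "X = F ` carrier sig.bc #>\<^bsub>add_monoid ?M\<^esub> m"
      by (auto simp: carrier_FactGroup)
    have pow: "m [^]\<^bsub>add_monoid ?M\<^esub> n = (coords (of_nat n * Witt (fst m)), coords (of_nat n * Witt (snd m)))" for n :: nat
    proof (induction n)
      case 0
      then show ?case
        by (simp add: coords_eq_0)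
    next
      case (Suc n)
      then show ?case
        by (simp add: nat_pow_def distrib_right coords_add witt_add_commute[OF p])
    qed
    define u where "u = (Witt (snd m) :: 'k fps witt_vec)"
    \<comment> \<open>The pair \<open>u = snd m\<close>, \<open>v = p ^ 5 * fst m - a * u\<close> is
      a preimage of \<open>p ^ 5\<close> times \<open>m\<close>, so \<open>p ^ 5\<close> kills the
      cokernel.\<close>
    have "m [^]\<^bsub>add_monoid ?M\<^esub> (p ^ 5) =
        (coords (a * u + (of_nat p ^ 5 * Witt (fst m) - a * u)), coords (of_nat p ^ 5 * u))"
      unfolding pow u_def by simp
    then have mem: "m [^]\<^bsub>add_monoid ?M\<^esub> (p ^ 5) \<in> F ` carrier sig.bc"
      unfolding image by blast
    have "X [^]\<^bsub>add_monoid ?M Mod F ` carrier sig.bc\<^esub> (p ^ 5) =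
        F ` carrier sig.bc #>\<^bsub>add_monoid ?M\<^esub> (m [^]\<^bsub>add_monoid ?M\<^esub> (p ^ 5))"
      unfolding X by (rule N.FactGroup_pow) simp
    also have "\<dots> = F ` carrier sig.bc"
      by (rule N.rcos_const[OF M.a_group mem])
    finally show "X [^]\<^bsub>add_monoid ?M Mod F ` carrier sig.bc\<^esub> (p ^ 5) =
        \<one>\<^bsub>add_monoid ?M Mod F ` carrier sig.bc\<^esub>"
      by (simp only: one_FactGroup)
  qed
  \<comment> \<open>A representative of the vector with coordinates
    \<open>(x, p ^ 5 * \<sigma> x)\<close>.\<close>
  define c :: "(('k fps witt \<times> 'k fps witt) \<times> 'k fls witt) \<Rightarrow>\<^sub>0 int"
    where "c = frag_of ((witt_one, \<lambda>_. 0), coords x) +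
      frag_of ((\<lambda>_. 0, witt_one), coords (of_nat p ^ 5 * frob x))"
  have c: "gen.tcoord1 c = x" "gen.tcoord2 c = of_nat p ^ 5 * frob x"
    by (simp_all add: c_def gen.tcoord_add gen.tcoord_of gen.Witt_one gen.Witt_zero)
  have generic: "generic_module p ?M = gen.bc"
    by (simp add: generic_module_def)
  have "gen.cls c \<notin> to_generic p ?M ` carrier ?M"
  proof
    assume "gen.cls c \<in> to_generic p ?M ` carrier ?M"
    then obtain m where "gen.cls c = gen.cls (frag_of (m, witt_one))"
      by (auto simp: to_generic_def tensor_def)
    then have "x = wmap ?\<iota> (Witt (fst m))"
      by (simp add: gen.cls_eq_iff c gen.tcoord_of gen.Witt_one)
    \<comment> \<open>Lying in \<open>M\<close> would make the zeroth component of \<open>x\<close>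
      a power series.\<close>
    then have "coords x 0 = ?\<iota> (fst m 0)"
      by (simp add: wmap_def)
    with x0 show False
      by simp
  qed
  moreover have "frob_generic p ?M F (gen.cls c) = gen.cls c"
  proof -
    let ?f = "frob_semilinear p ?M F"
    let ?E = "frag_extend (\<lambda>(m, s :: 'k fls witt). frag_of (?f m, witt_frob p s))"
    have f: "?f m = (coords (a * frob (Witt (fst m)) + frob (Witt (snd m))), coords (of_nat p ^ 5 * frob (Witt (fst m))))" for m
      unfolding frob_semilinear_def tensor_def witt_ring_simps F sig.tcoord_of sig.Witt_one by simp
    \<comment> \<open>The semilinear extension in coordinates. It shows both that the map is well
      defined on classes and that being fixed amounts to the equation for \<open>x\<close>.\<close>
    have E: "gen.tcoord1 (?E d) = wmap ?\<iota> a * frob (gen.tcoord1 d) + frob (gen.tcoord2 d) \<and>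
        gen.tcoord2 (?E d) = of_nat p ^ 5 * frob (gen.tcoord1 d)" for d
    proof (induction d rule: frag_induction[OF subset_UNIV])
      case (2 ms)
      then show ?case
        by (cases ms) (simp add: frag_extend_of gen.tcoord_of f Witt_frob gen.hom_add gen.hom_mult gen.hom_power
          gen.hom_of_nat \<iota>_frob frob_K.hom_mult algebra_simps)
    next
      case (3 d d')
      then show ?case
        by (simp add: frag_extend_diff gen.tcoord_diff frob_K.hom_diff algebra_simps)
    qed simp
    have "frob_generic p ?M F (gen.cls c) = gen.cls (?E c)"
      unfolding frob_generic_def by (rule gen.tensor_map_cls) (simp add: E)
    also have "\<dots> = gen.cls c"
      unfolding gen.cls_eq_iff using x
      by (simp add: E c frob_K.hom_mult frob_K.hom_power frob_K.hom_of_nat)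
    finally show ?thesis .
  qed
  ultimately have "module (W_fps p) ?M \<and> free_of_rank (W_fps p) ?M 2 \<and>
      isogeny p (W_fps p) (sigma_pullback p ?M) ?M F \<and>
      gen.cls c \<in> carrier (generic_module p ?M) - to_generic p ?M ` carrier ?M \<and>
      frob_generic p ?M F (gen.cls c) = gen.cls c"
    using hom ker coker
    by (auto simp: isogeny_def pullback generic gen.carrier_bc module_witt_square[OF p]
      free_of_rank_witt_square[OF p])
  then show ?thesis
    by blast
qed

end
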